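(* Let $(\Phi_n)_{n\geq0}\subset\mathcal{S}^*(M)$ be an $M$-generalized martingale. Then the following conditions are equivalent: (1) $(\Phi_n)_{n\geq0}$ is strongly convergent in $\mathcal{S}^*(M)$; (2) $(\Phi_n)_{n\geq0}$ is weakly bounded in $\mathcal{S}^*(M)$; (3) $(\Phi_n)_{n\geq0}$ is strongly bounded in $\mathcal{S}^*(M)$; (4) $(\Phi_n)_{n\geq0}$ is bounded in $\mathcal{S}_p^*(M)$ for some $p\geq0$ (that is, it is contained in $\mathcal{S}_p^*(M)$ and norm-bounded there).
   Context: $\mathbb{N}$ is the set of nonnegative integers and $\Gamma$ is the set of all finite subsets of $\mathbb{N}$. $(\Omega,\mathcal{F},P)$ is a probability space with expectation $\mathbb{E}$. A discrete-time normal martingale is a real-valued square integrable process $M=(M_n)_{n\in\mathbb{N}}$ on it such that $\mathbb{E}[M_0|\mathcal{F}_{-1}]=0$, $\mathbb{E}[M_n|\mathcal{F}_{n-1}]=M_{n-1}$ for $n\ge1$, $\mathbb{E}[M_0^2|\mathcal{F}_{-1}]=1$ and $\mathbb{E}[M_n^2|\mathcal{F}_{n-1}]=M_{n-1}^2+1$ for $n\ge1$, where $\mathcal{F}_{-1}=\{\emptyset,\Omega\}$ and $\mathcal{F}_n=\sigma(M_k;0\le k\le n)$. Its associated discrete-time normal noise is $Z_0=M_0$, $Z_n=M_n-M_{n-1}$ ($n\ge 1$). Put $Z_\emptyset=1$ and $Z_\sigma=\prod_{i\in\sigma}Z_i$ for nonempty $\sigma\in\Gamma$. Let $\mathcal{F}_\infty=\sigma(M_n;n\in\mathbb{N})$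 and let $\mathcal{L}^2(M)=\mathcal{L}^2(\Omega,\mathcal{F}_\infty,P)$ be the complex Hilbert space with inner product $\langle\cdot,\cdot\rangle$ (conjugate-linear in the first argument, linear in the second) and norm $\|\cdot\|$. $M$ has the chaotic representation property if $\{Z_\sigma\mid\sigma\in\Gamma\}$ is total in $\mathcal{L}^2(M)$. Standing assumption: $M$ is a discrete-time normal martingale with the chaotic representation property; then $\{Z_\sigma\mid\sigma\in\Gamma\}$ is an orthonormal basis of $\mathcal{L}^2(M)$. Let $\lambda_\emptyset=1$ and $\lambda_\sigma=\prod_{k\in\sigma}(k+1)$ for nonempty $\sigma\in\Gamma$. For $p\ge0$ put $\|\xi\|_p^2=\sum_{\sigma\in\Gamma}\lambda_\sigma^{2p}|\langle Z_\sigma,\xi\rangle|^2$ and $\mathcal{S}_p(M)=\{\xi\in\mathcal{L}^2(M)\mid\|\xi\|_p<\infty\}$, a Hilbert space with norm $\|\cdot\|_p$. Let $\mathcal{S}(M)=\bigcap_{p=0}^\infty\mathcal{S}_p(M)$ with the topology generated by the norms $\{\|\cdot\|_p\}_{p\ge0}$; it contains all $Z_\sigma$ and is dense in each $\mathcal{S}_p(M)$. $\mathcal{S}_p^*(M)$ is the dual of $\mathcal{S}_p(M)$, with dual norm $\|\cdot\|_{-p}$, and $\mathcal{S}^*(M)$ is the topological dual of $\mathcal{S}(M)$; by restriction of functionals to $\mathcal{S}(M)$ one regards $\mathcal{S}_p^*(M)\subset\mathcal{S}^*(M)$, and $\mathcal{S}^*(M)=\bigcup_{p=0}^\infty\mathcal{S}_p^*(M)$.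 Elements of $\mathcal{S}^*(M)$ are called generalized functionals of $M$. The canonical bilinear form is $\langle\!\langle\Phi,\xi\rangle\!\rangle=\Phi(\xi)$ for $\Phi\in\mathcal{S}^*(M)$, $\xi\in\mathcal{S}(M)$. The strong topology of $\mathcal{S}^*(M)$ is that of uniform convergence on bounded subsets of $\mathcal{S}(M)$; the weak topology is that of pointwise convergence on $\mathcal{S}(M)$. Strongly convergent means convergent (to some element of $\mathcal{S}^*(M)$) in the strong topology; strongly (resp. weakly) bounded means bounded in the strong (resp. weak) topology. The Fock transform of $\Phi\in\mathcal{S}^*(M)$ is the function $\widehat{\Phi}$ on $\Gamma$ given by $\widehat{\Phi}(\sigma)=\langle\!\langle\Phi,Z_\sigma\rangle\!\rangle$. For $n\ge0$, $\Gamma_{n]}$ is the power set of $\{0,1,\dots,n\}$ and $\mathbf{I}_{n]}$ is its indicator function on $\Gamma$. A sequence $(\Phi_n)_{n\ge0}\subset\mathcal{S}^*(M)$ is called an $M$-generalized martingale if $\widehat{\Phi_n}(\sigma)=\mathbf{I}_{n]}(\sigma)\widehat{\Phi_{n+1}}(\sigma)$ for all $\sigma\in\Gamma$ and $n\ge0$. *)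

theory Defs
  imports "HOL-Probability.Probability"
begin

section \<open>Seminormed spaces of complex-valued functions\<close>

text \<open>
  Every vector space below is a carrier set of functions into \<^typ>\<open>complex\<close> with pointwise
  operations: random variables on the one hand, functionals on random variables on the other.
  A topological dual consists of functionals that are set to 0 off their domain, so that it is
  itself closed under the pointwise operations.
\<close>

definition seminorm_topology ::
    "('i \<Rightarrow> complex) set \<Rightarrow> (('i \<Rightarrow> complex) \<Rightarrow> real) set \<Rightarrow> ('i \<Rightarrow> complex) topology" where
  "seminorm_topology V Q =
     topology_generated_by {{g \<in> V. q (\<lambda>x. g x - f x) < e} | q f e. q \<in> Q \<and> f \<in> V \<and> e > 0}"

definition topological_dual ::
    "('i \<Rightarrow> complex) set \<Rightarrow> ('i \<Rightarrow> complex) topology \<Rightarrow> (('i \<Rightarrow> complex) \<Rightarrow> complex) set" where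
  "topological_dual V T =
     {F. (\<forall>f\<in>V. \<forall>g\<in>V. \<forall>a b. F (\<lambda>x. a * f x + b * g x) = a * F f + b * F g)
       \<and> (\<forall>f. f \<notin> V \<longrightarrow> F f = 0)
       \<and> continuous_map T euclidean F}"

definition restrict_functional ::
    "('i \<Rightarrow> complex) set \<Rightarrow> (('i \<Rightarrow> complex) \<Rightarrow> complex) \<Rightarrow> (('i \<Rightarrow> complex) \<Rightarrow> complex)" where
  "restrict_functional V F = (\<lambda>f. if f \<in> V then F f else 0)"

text \<open>Boundedness in a topological vector space: absorbed by every neighbourhood of 0.\<close>

definition tvs_bounded :: "('i \<Rightarrow> complex) topology \<Rightarrow> ('i \<Rightarrow> complex) set \<Rightarrow> bool" where
  "tvs_bounded T A \<longleftrightarrow> A \<subseteq> topspace T \<and>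
     (\<forall>U. openin T U \<and> (\<lambda>_. 0) \<in> U \<longrightarrow>
        (\<exists>s>0. \<forall>t>s. A \<subseteq> (\<lambda>f x. complex_of_real t * f x) ` U))"

definition strong_dual_topology ::
    "('i \<Rightarrow> complex) set \<Rightarrow> ('i \<Rightarrow> complex) topology \<Rightarrow> (('i \<Rightarrow> complex) \<Rightarrow> complex) topology" where
  "strong_dual_topology V T = seminorm_topology (topological_dual V T)
     {\<lambda>F. SUP f\<in>B. cmod (F f) | B. tvs_bounded T B \<and> B \<noteq> {}}"

definition weak_dual_topology ::
    "('i \<Rightarrow> complex) set \<Rightarrow> ('i \<Rightarrow> complex) topology \<Rightarrow> (('i \<Rightarrow> complex) \<Rightarrow> complex) topology" where
  "weak_dual_topology V T = seminorm_topology (topological_dual V T) {\<lambda>F. cmod (F f) | f. f \<in> V}"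


section \<open>Discrete-time normal martingales\<close>

definition generated_algebra :: "'a measure \<Rightarrow> (nat \<Rightarrow> 'a \<Rightarrow> real) \<Rightarrow> nat set \<Rightarrow> 'a measure" where
  "generated_algebra P M I =
     sigma (space P) {M k -` A \<inter> space P | k A. k \<in> I \<and> A \<in> sets borel}"

text \<open>
  The \<open>\<sigma>\<close>-algebra of the past strictly before time \<open>n\<close> is \<open>generated_algebra P M {..<n}\<close>;
  for \<open>n = 0\<close> it is the trivial one.
\<close>

definition normal_martingale :: "'a measure \<Rightarrow> (nat \<Rightarrow> 'a \<Rightarrow> real) \<Rightarrow> bool" where
  "normal_martingale P M \<longleftrightarrow>
     prob_space P
   \<and> (\<forall>n. M n \<in> borel_measurable P \<and> integrable P (\<lambda>x. (M n x)\<^sup>2))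
   \<and> (AE x in P. real_cond_exp P (generated_algebra P M {..<0}) (M 0) x = 0)
   \<and> (\<forall>n\<ge>1. AE x in P. real_cond_exp P (generated_algebra P M {..<n}) (M n) x = M (n - 1) x)
   \<and> (AE x in P. real_cond_exp P (generated_algebra P M {..<0}) (\<lambda>y. (M 0 y)\<^sup>2) x = 1)
   \<and> (\<forall>n\<ge>1. AE x in P. real_cond_exp P (generated_algebra P M {..<n}) (\<lambda>y. (M n y)\<^sup>2) x
                        = (M (n - 1) x)\<^sup>2 + 1)"

definition normal_noise :: "(nat \<Rightarrow> 'a \<Rightarrow> real) \<Rightarrow> nat \<Rightarrow> 'a \<Rightarrow> real" where
  "normal_noise M n x = (if n = 0 then M 0 x else M n x - M (n - 1) x)"

definition Zprod :: "(nat \<Rightarrow> 'a \<Rightarrow> real) \<Rightarrow> nat set \<Rightarrow> 'a \<Rightarrow> complex" where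
  "Zprod M \<sigma> x = complex_of_real (\<Prod>i\<in>\<sigma>. normal_noise M i x)"

abbreviation Gam :: "nat set set" where
  "Gam \<equiv> {\<sigma>. finite \<sigma>}"

text \<open>
  Elements of \<open>L\<^sup>2\<close> are represented by functions instead of classes modulo equality almost
  everywhere, so the norms below are seminorms vanishing exactly on the functions that are 0
  almost everywhere. Continuous functionals do not distinguish two representatives of a class;
  see \<open>S_dual_cong_AE\<close>.
\<close>

definition L2 :: "'a measure \<Rightarrow> (nat \<Rightarrow> 'a \<Rightarrow> real) \<Rightarrow> ('a \<Rightarrow> complex) set" where
  "L2 P M = {\<xi> \<in> borel_measurable (generated_algebra P M UNIV). integrable P (\<lambda>x. (cmod (\<xi> x))\<^sup>2)}"

definition L2_inner :: "'a measure \<Rightarrow> ('a \<Rightarrow> complex) \<Rightarrow> ('a \<Rightarrow> complex) \<Rightarrow> complex" where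
  "L2_inner P \<xi> \<eta> = (LINT x|P. cnj (\<xi> x) * \<eta> x)"

definition L2_norm :: "'a measure \<Rightarrow> ('a \<Rightarrow> complex) \<Rightarrow> real" where
  "L2_norm P \<xi> = sqrt (LINT x|P. (cmod (\<xi> x))\<^sup>2)"

definition Zspan :: "(nat \<Rightarrow> 'a \<Rightarrow> real) \<Rightarrow> ('a \<Rightarrow> complex) set" where
  "Zspan M = {\<lambda>x. \<Sum>\<sigma>\<in>A. c \<sigma> * Zprod M \<sigma> x | A c. finite A \<and> A \<subseteq> Gam}"

definition chaotic_representation :: "'a measure \<Rightarrow> (nat \<Rightarrow> 'a \<Rightarrow> real) \<Rightarrow> bool" where
  "chaotic_representation P M \<longleftrightarrow>
     seminorm_topology (L2 P M) {L2_norm P} closure_of Zspan M = L2 P M"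


section \<open>Testing and generalized functionals\<close>

definition lam :: "nat set \<Rightarrow> real" where
  "lam \<sigma> = (\<Prod>k\<in>\<sigma>. real (k + 1))"

definition Sp :: "'a measure \<Rightarrow> (nat \<Rightarrow> 'a \<Rightarrow> real) \<Rightarrow> nat \<Rightarrow> ('a \<Rightarrow> complex) set" where
  "Sp P M p = {\<xi> \<in> L2 P M.
     (\<lambda>\<sigma>. lam \<sigma> ^ (2 * p) * (cmod (L2_inner P (Zprod M \<sigma>) \<xi>))\<^sup>2) summable_on Gam}"

text \<open>Only meaningful on \<open>Sp P M p\<close>: elsewhere the sum diverges and \<^const>\<open>infsum\<close> is 0.\<close>

definition Sp_norm :: "'a measure \<Rightarrow> (nat \<Rightarrow> 'a \<Rightarrow> real) \<Rightarrow> nat \<Rightarrow> ('a \<Rightarrow> complex) \<Rightarrow> real" where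
  "Sp_norm P M p \<xi> =
     sqrt (\<Sum>\<^sub>\<infinity>\<sigma>\<in>Gam. lam \<sigma> ^ (2 * p) * (cmod (L2_inner P (Zprod M \<sigma>) \<xi>))\<^sup>2)"

definition S_space :: "'a measure \<Rightarrow> (nat \<Rightarrow> 'a \<Rightarrow> real) \<Rightarrow> ('a \<Rightarrow> complex) set" where
  "S_space P M = (\<Inter>p. Sp P M p)"

definition S_topology :: "'a measure \<Rightarrow> (nat \<Rightarrow> 'a \<Rightarrow> real) \<Rightarrow> ('a \<Rightarrow> complex) topology" where
  "S_topology P M = seminorm_topology (S_space P M) (range (Sp_norm P M))"

definition S_dual :: "'a measure \<Rightarrow> (nat \<Rightarrow> 'a \<Rightarrow> real) \<Rightarrow> (('a \<Rightarrow> complex) \<Rightarrow> complex) set" where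
  "S_dual P M = topological_dual (S_space P M) (S_topology P M)"

definition Sp_dual ::
    "'a measure \<Rightarrow> (nat \<Rightarrow> 'a \<Rightarrow> real) \<Rightarrow> nat \<Rightarrow> (('a \<Rightarrow> complex) \<Rightarrow> complex) set" where
  "Sp_dual P M p = topological_dual (Sp P M p) (seminorm_topology (Sp P M p) {Sp_norm P M p})"

definition Sp_dual_norm ::
    "'a measure \<Rightarrow> (nat \<Rightarrow> 'a \<Rightarrow> real) \<Rightarrow> nat \<Rightarrow> (('a \<Rightarrow> complex) \<Rightarrow> complex) \<Rightarrow> real" where
  "Sp_dual_norm P M p F = (SUP \<xi>\<in>{\<xi> \<in> Sp P M p. Sp_norm P M p \<xi> \<le> 1}. cmod (F \<xi>))"

definition strong_topology ::
    "'a measure \<Rightarrow> (nat \<Rightarrow> 'a \<Rightarrow> real) \<Rightarrow> (('a \<Rightarrow> complex) \<Rightarrow> complex) topology" where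
  "strong_topology P M = strong_dual_topology (S_space P M) (S_topology P M)"

definition weak_topology ::
    "'a measure \<Rightarrow> (nat \<Rightarrow> 'a \<Rightarrow> real) \<Rightarrow> (('a \<Rightarrow> complex) \<Rightarrow> complex) topology" where
  "weak_topology P M = weak_dual_topology (S_space P M) (S_topology P M)"

definition Fock_transform ::
    "(nat \<Rightarrow> 'a \<Rightarrow> real) \<Rightarrow> (('a \<Rightarrow> complex) \<Rightarrow> complex) \<Rightarrow> nat set \<Rightarrow> complex" where
  "Fock_transform M \<Phi> \<sigma> = \<Phi> (Zprod M \<sigma>)"

definition generalized_martingale ::
    "'a measure \<Rightarrow> (nat \<Rightarrow> 'a \<Rightarrow> real) \<Rightarrow> (nat \<Rightarrow> ('a \<Rightarrow> complex) \<Rightarrow> complex) \<Rightarrow> bool" where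
  "generalized_martingale P M \<Phi> \<longleftrightarrow>
     (\<forall>n. \<Phi> n \<in> S_dual P M)
   \<and> (\<forall>n. \<forall>\<sigma>\<in>Gam. Fock_transform M (\<Phi> n) \<sigma>
                   = indicator (Pow {0..n}) \<sigma> * Fock_transform M (\<Phi> (Suc n)) \<sigma>)"


section \<open>Functionals do not depend on representatives\<close>

lemma topological_dual_indistinguishable:
  assumes F: "F \<in> topological_dual V (seminorm_topology V Q)"
    and V: "f \<in> V" "g \<in> V" and "Q \<noteq> {}"
    and null: "\<And>q. q \<in> Q \<Longrightarrow> q (\<lambda>x. f x - f x) = 0"
    and eq: "\<And>q h. q \<in> Q \<Longrightarrow> h \<in> V \<Longrightarrow> q (\<lambda>x. f x - h x) = q (\<lambda>x. g x - h x)"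
  shows "F f = F g"
proof (rule ccontr)
  let ?T = "seminorm_topology V Q"
  have same: "f \<in> U \<longleftrightarrow> g \<in> U" if "openin ?T U" for U
  proof -
    have "generate_topology_on {{g \<in> V. q (\<lambda>x. g x - f x) < e} | q f e. q \<in> Q \<and> f \<in> V \<and> e > 0} U"
      using that unfolding seminorm_topology_def by (rule openin_topology_generated_by)
    then show ?thesis
    proof induction
      case (Basis s)
      then obtain q h e where "s = {g \<in> V. q (\<lambda>x. g x - h x) < e}" "q \<in> Q" "h \<in> V"
        by blast
      then show ?case
        using V eq[of q h] by simp
    qed auto
  qed
  have cont: "continuous_map ?T euclidean F"
    using F by (simp add: topological_dual_def)
  obtain q where q: "q \<in> Q" using \<open>Q \<noteq> {}\<close> by blast
  have "openin ?T {h \<in> V. q (\<lambda>x. h x - f x) < 1}"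
    unfolding seminorm_topology_def
    by (rule topology_generated_by_Basis) (use q V in force)
  then have "f \<in> topspace ?T"
    using V null[OF q] openin_subset by fastforce
  moreover have "openin ?T {x \<in> topspace ?T. F x \<in> - {F g}}"
    by (rule openin_continuous_map_preimage[OF cont]) auto
  moreover assume "F f \<noteq> F g"
  ultimately show False
    using same by fastforce
qed

lemma L2_measurable:
  assumes "normal_martingale P M" "\<xi> \<in> L2 P M"
  shows "\<xi> \<in> borel_measurable P"
proof -
  let ?G = "{M k -` A \<inter> space P | k A. k \<in> UNIV \<and> A \<in> sets borel}"
  have "?G \<subseteq> sets P"
    using assms(1) by (auto simp: normal_martingale_def intro: measurable_sets)
  then have "sets (generated_algebra P M UNIV) \<subseteq> sets P"
    unfolding generated_algebra_def by (subst sets_measure_of) (auto intro!: sets.sigma_sets_subset)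
  moreover have "space (generated_algebra P M UNIV) = space P"
    by (simp add: generated_algebra_def space_measure_of_conv)
  ultimately show ?thesis
    using assms(2) by (auto simp: L2_def measurable_def)
qed

lemma Zprod_measurable:
  assumes "normal_martingale P M"
  shows "Zprod M \<sigma> \<in> borel_measurable P"
proof -
  have [measurable]: "M n \<in> borel_measurable P" for n
    using assms by (simp add: normal_martingale_def)
  have [measurable]: "normal_noise M n \<in> borel_measurable P" for n
    by (cases n) (simp_all add: normal_noise_def[abs_def])
  show ?thesis
    unfolding Zprod_def[abs_def] by measurable
qed

lemma Sp_norm_cong_AE:
  assumes M: "normal_martingale P M" and "AE x in P. \<xi> x = \<eta> x"
    and [measurable]: "\<xi> \<in> borel_measurable P" "\<eta> \<in> borel_measurable P"
  shows "Sp_norm P M p \<xi> = Sp_norm P M p \<eta>"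
proof -
  have "L2_inner P (Zprod M \<sigma>) \<xi> = L2_inner P (Zprod M \<sigma>) \<eta>" for \<sigma>
  proof -
    note [measurable] = Zprod_measurable[OF M, of \<sigma>]
    have [measurable]: "(\<lambda>x. cnj (Zprod M \<sigma> x)) \<in> borel_measurable P"
      by (rule borel_measurable_continuous_on[of cnj]) (auto intro: continuous_intros)
    show ?thesis
      unfolding L2_inner_def by (rule integral_cong_AE) (use assms(2) in auto)
  qed
  then show ?thesis
    by (simp add: Sp_norm_def)
qed

lemma S_dual_cong_AE:
  assumes M: "normal_martingale P M" and "F \<in> S_dual P M" "\<xi> \<in> S_space P M" "\<eta> \<in> S_space P M"
    and eq: "AE x in P. \<xi> x = \<eta> x"
  shows "F \<xi> = F \<eta>"
proof (rule topological_dual_indistinguishable[where F = F and V = "S_space P M" and Q = "range (Sp_norm P M)"])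
  show "F \<in> topological_dual (S_space P M) (seminorm_topology (S_space P M) (range (Sp_norm P M)))"
    using assms by (simp add: S_dual_def S_topology_def)
  have meas: "h \<in> borel_measurable P" if "h \<in> S_space P M" for h
    using that by (auto simp: S_space_def Sp_def intro!: L2_measurable[OF M])
  show "q (\<lambda>x. \<xi> x - h x) = q (\<lambda>x. \<eta> x - h x)"
    if "q \<in> range (Sp_norm P M)" "h \<in> S_space P M" for q h
    using that eq meas assms by (auto intro!: Sp_norm_cong_AE[OF M])
qed (use assms in \<open>auto simp: Sp_norm_def L2_inner_def\<close>)

end

theory Submission
  imports Defs
begin

text \<open>
  The Fock transform of \<open>\<Phi> n\<close> is \<open>a \<sigma>\<close> on the subsets \<open>\<sigma>\<close> of \<open>{0..n}\<close> and 0 elsewhere, for one fixed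
  function \<open>a\<close>, and \<open>\<Phi> n \<xi>\<close> is the finite sum of \<open>a \<sigma> * \<langle>Z\<^sub>\<sigma>, \<xi>\<rangle>\<close> over these subsets. Hence the norm
  of \<open>\<Phi> n\<close> in \<open>S\<^sub>p\<^sup>*\<close> is the square root of the sum \<open>E p n\<close> of \<open>(\<bar>a \<sigma>\<bar> / \<lambda>\<^sub>\<sigma>\<^sup>p)\<^sup>2\<close>, and all four
  conditions are equivalent to the boundedness in \<open>n\<close> of \<open>E p n\<close> for some \<open>p\<close>. If \<open>E p\<close> is bounded, the tails of
  the defining series of the limit are small in \<open>S\<^sub>p\<^sup>*\<close>, uniformly on bounded subsets of \<open>S\<close>.

  If every \<open>E p\<close> is unbounded, choose \<open>N 0 < N 1 < \<dots>\<close> such that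
  the block of indices \<open>\<sigma>\<close> contained in \<open>{0..N (k + 1)}\<close> but not in \<open>{0..N k}\<close> contributes
  \<open>e k > 8\<^sup>k\<close> to \<open>E k\<close>. The vector \<open>\<xi>\<close> with coefficients \<open>cnj (a \<sigma>) / (\<lambda>\<^sub>\<sigma>\<^sup>2\<^sup>k * e k)\<close> on the \<open>k\<close>-th block
  lies in \<open>S\<close>, while \<open>\<Phi> (N k) \<xi> = k\<close>, so the martingale is not weakly bounded.
\<close>

section \<open>Seminormed spaces and their duals\<close>

definition function_space :: "('i \<Rightarrow> complex) set \<Rightarrow> bool" where
  "function_space V \<longleftrightarrow> (\<lambda>_. 0) \<in> V \<and> (\<forall>f\<in>V. \<forall>g\<in>V. \<forall>a b. (\<lambda>x. a * f x + b * g x) \<in> V)"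

definition seminorm_on :: "('i \<Rightarrow> complex) set \<Rightarrow> (('i \<Rightarrow> complex) \<Rightarrow> real) \<Rightarrow> bool" where
  "seminorm_on V q \<longleftrightarrow> (\<forall>f\<in>V. 0 \<le> q f) \<and> (\<forall>f\<in>V. \<forall>g\<in>V. q (\<lambda>x. f x + g x) \<le> q f + q g)
     \<and> (\<forall>f\<in>V. \<forall>c. q (\<lambda>x. c * f x) = cmod c * q f)"

lemma seminorm_onD:
  assumes "seminorm_on V q"
  shows seminorm_on_nonneg: "f \<in> V \<Longrightarrow> 0 \<le> q f"
    and seminorm_on_add: "f \<in> V \<Longrightarrow> g \<in> V \<Longrightarrow> q (\<lambda>x. f x + g x) \<le> q f + q g"
    and seminorm_on_cmult: "f \<in> V \<Longrightarrow> q (\<lambda>x. c * f x) = cmod c * q f"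
  using assms by (auto simp: seminorm_on_def)

lemma function_spaceD:
  assumes "function_space V"
  shows function_space_zero: "(\<lambda>_. 0) \<in> V"
    and function_space_lincomb: "f \<in> V \<Longrightarrow> g \<in> V \<Longrightarrow> (\<lambda>x. a * f x + b * g x) \<in> V"
    and function_space_add: "f \<in> V \<Longrightarrow> g \<in> V \<Longrightarrow> (\<lambda>x. f x + g x) \<in> V"
    and function_space_diff: "f \<in> V \<Longrightarrow> g \<in> V \<Longrightarrow> (\<lambda>x. f x - g x) \<in> V"
    and function_space_cmult: "f \<in> V \<Longrightarrow> (\<lambda>x. a * f x) \<in> V"
proof -
  have *: "(\<lambda>x. a * f x + b * g x) \<in> V" if "f \<in> V" "g \<in> V" for f g a b
    using assms that by (auto simp: function_space_def)
  show "(\<lambda>_. 0) \<in> V"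
    using assms by (auto simp: function_space_def)
  then show "f \<in> V \<Longrightarrow> (\<lambda>x. a * f x) \<in> V"
    using *[of f "\<lambda>_. 0" a 0] by simp
  show "f \<in> V \<Longrightarrow> g \<in> V \<Longrightarrow> (\<lambda>x. a * f x + b * g x) \<in> V"
    by (rule *)
  show "f \<in> V \<Longrightarrow> g \<in> V \<Longrightarrow> (\<lambda>x. f x + g x) \<in> V"
    using *[of f g 1 1] by simp
  show "f \<in> V \<Longrightarrow> g \<in> V \<Longrightarrow> (\<lambda>x. f x - g x) \<in> V"
    using *[of f g 1 "-1"] by simp
qed

lemma function_space_sum:
  assumes "function_space V" "\<And>i. i \<in> A \<Longrightarrow> f i \<in> V"
  shows "(\<lambda>x. \<Sum>i\<in>A. f i x) \<in> V"
  using assms(2)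
  by (induction A rule: infinite_finite_induct)
    (auto intro: function_space_zero[OF assms(1)] function_space_add[OF assms(1)])

text \<open>Stated once for a general family \<open>Q\<close> because it is used four times: for the
  single norm on \<open>Sp P M p\<close>, for all norms together on \<open>S_space P M\<close>, and
  for the weak and the strong seminorms on the dual. Distinct members of \<open>V\<close> may be
  indistinguishable under \<open>Q\<close>, as happens for functions that agree almost
  everywhere.\<close>

locale seminormed_space =
  fixes V :: "('i \<Rightarrow> complex) set" and Q :: "(('i \<Rightarrow> complex) \<Rightarrow> real) set"
  assumes V: "function_space V" and Q_nonempty: "Q \<noteq> {}"
    and seminorms: "q \<in> Q \<Longrightarrow> seminorm_on V q"
begin

abbreviation "T \<equiv> seminorm_topology V Q"

section \<open>Neighbourhoods, bounded sets and convergence in a seminorm topology\<close>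

lemma seminorm_zero: "q \<in> Q \<Longrightarrow> q (\<lambda>_. 0) = 0"
  using seminorm_on_cmult[OF seminorms function_space_zero[OF V], of q 0] by simp

lemma seminorm_diff_triangle:
  assumes "q \<in> Q" "f \<in> V" "g \<in> V" "h \<in> V"
  shows "q (\<lambda>x. f x - h x) \<le> q (\<lambda>x. f x - g x) + q (\<lambda>x. g x - h x)"
  using seminorm_on_add[OF seminorms[OF \<open>q \<in> Q\<close>], of "\<lambda>x. f x - g x" "\<lambda>x. g x - h x"]
    assms function_space_diff[OF V] by simp

lemma openin_ball:
  assumes "q \<in> Q" "f \<in> V" "e > 0"
  shows "openin T {g \<in> V. q (\<lambda>x. g x - f x) < e}"
  unfolding seminorm_topology_def
  by (rule topology_generated_by_Basis, rule CollectI) (rule exI[of _ q], rule exI[of _ f], rule exI[of _ e], simp add: assms)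

lemma topspace_seminorm_topology: "topspace T = V"
proof
  show "topspace T \<subseteq> V"
    unfolding seminorm_topology_def topology_generated_by_topspace by blast
  obtain q where q: "q \<in> Q"
    using Q_nonempty by blast
  show "V \<subseteq> topspace T"
  proof
    fix f assume f: "f \<in> V"
    then have "f \<in> {g \<in> V. q (\<lambda>x. g x - f x) < 1}"
      using seminorm_zero[OF q] by simp
    then show "f \<in> topspace T"
      using openin_subset[OF openin_ball[OF q f zero_less_one]] by blast
  qed
qed

text \<open>The generating balls form only a subbase and have arbitrary centres. In the induction
  over generated open sets, the triangle inequality recentres a ball at \<open>f\<close>, and an
  intersection takes the union of the two finite sets of seminorms and the smaller radius.\<close>

lemma openin_contains_balls:
  assumes "openin T U" "f \<in> U"
  obtains Q' e where "finite Q'" "Q' \<subseteq> Q" "e > 0" "{g \<in> V. \<forall>q\<in>Q'. q (\<lambda>x. g x - f x) < e} \<subseteq> U"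
proof -
  have "generate_topology_on {{g \<in> V. q (\<lambda>x. g x - f x) < e} | q f e. q \<in> Q \<and> f \<in> V \<and> e > 0} U"
    using assms(1) unfolding seminorm_topology_def by (rule openin_topology_generated_by)
  then have "\<forall>f\<in>U. \<exists>Q' e. finite Q' \<and> Q' \<subseteq> Q \<and> e > 0 \<and> {g \<in> V. \<forall>q\<in>Q'. q (\<lambda>x. g x - f x) < e} \<subseteq> U"
  proof induction
    case (Int A B)
    note IH = Int.IH
    show ?case
    proof
      fix f assume f: "f \<in> A \<inter> B"
      obtain Q1 e1 where 1: "finite Q1" "Q1 \<subseteq> Q" "e1 > 0" "{g \<in> V. \<forall>q\<in>Q1. q (\<lambda>x. g x - f x) < e1} \<subseteq> A"
        using IH f by (meson IntD1 IntD2)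
      obtain Q2 e2 where 2: "finite Q2" "Q2 \<subseteq> Q" "e2 > 0" "{g \<in> V. \<forall>q\<in>Q2. q (\<lambda>x. g x - f x) < e2} \<subseteq> B"
        using IH f by (meson IntD1 IntD2)
      show "\<exists>Q' e. finite Q' \<and> Q' \<subseteq> Q \<and> e > 0 \<and> {g \<in> V. \<forall>q\<in>Q'. q (\<lambda>x. g x - f x) < e} \<subseteq> A \<inter> B"
        by (rule exI[of _ "Q1 \<union> Q2"], rule exI[of _ "min e1 e2"]) (use 1 2 in auto)
    qed
  next
    case (UN K)
    show ?case
    proof
      fix f assume "f \<in> \<Union>K"
      then obtain k where k: "k \<in> K" "f \<in> k" by blast
      with UN obtain Q' e where "finite Q'" "Q' \<subseteq> Q" "e > 0" "{g \<in> V. \<forall>q\<in>Q'. q (\<lambda>x. g x - f x) < e} \<subseteq> k"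
        by meson
      with k show "\<exists>Q' e. finite Q' \<and> Q' \<subseteq> Q \<and> e > 0 \<and> {g \<in> V. \<forall>q\<in>Q'. q (\<lambda>x. g x - f x) < e} \<subseteq> \<Union>K"
        by (meson Union_upper order_trans)
    qed
  next
    case (Basis s)
    then obtain q h e where s: "s = {g \<in> V. q (\<lambda>x. g x - h x) < e}" and *: "q \<in> Q" "h \<in> V" "e > 0"
      by blast
    show ?case
    proof
      fix f assume f: "f \<in> s"
      have "{g \<in> V. \<forall>q'\<in>{q}. q' (\<lambda>x. g x - f x) < e - q (\<lambda>x. f x - h x)} \<subseteq> s"
      proof
        fix g assume "g \<in> {g \<in> V. \<forall>q'\<in>{q}. q' (\<lambda>x. g x - f x) < e - q (\<lambda>x. f x - h x)}"
        then have "g \<in> V" "q (\<lambda>x. g x - f x) < e - q (\<lambda>x. f x - h x)"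
          by simp_all
        with seminorm_diff_triangle[of q g f h] f * show "g \<in> s"
          by (simp add: s)
      qed
      moreover have "finite {q}" "{q} \<subseteq> Q" "e - q (\<lambda>x. f x - h x) > 0"
        using f * by (simp_all add: s)
      ultimately show "\<exists>Q' e. finite Q' \<and> Q' \<subseteq> Q \<and> e > 0 \<and> {g \<in> V. \<forall>q\<in>Q'. q (\<lambda>x. g x - f x) < e} \<subseteq> s"
        by blast
    qed
  qed auto
  then show thesis
    using assms(2) that by meson
qed

text \<open>In one direction the unit ball of \<open>q\<close> absorbs \<open>A\<close> and thereby
  bounds \<open>q\<close> on it. In the other, only finitely many seminorms are needed to cut out a
  ball inside a given neighbourhood of 0, so one scaling factor serves all of them.\<close>

lemma tvs_bounded_iff: "tvs_bounded T A \<longleftrightarrow> A \<subseteq> V \<and> (\<forall>q\<in>Q. \<exists>C. \<forall>f\<in>A. q f \<le> C)"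
proof (intro iffI conjI ballI)
  assume A: "tvs_bounded T A"
  then show "A \<subseteq> V"
    by (simp add: tvs_bounded_def topspace_seminorm_topology)
  fix q assume q: "q \<in> Q"
  let ?U = "{g \<in> V. q g < 1}"
  have "openin T ?U" "(\<lambda>_. 0) \<in> ?U"
    using openin_ball[OF q function_space_zero[OF V], of 1] function_space_zero[OF V] seminorm_zero[OF q]
    by simp_all
  then obtain s where s: "s > 0" "\<And>t. t > s \<Longrightarrow> A \<subseteq> (\<lambda>f x. complex_of_real t * f x) ` ?U"
    using A unfolding tvs_bounded_def by meson
  have "q f \<le> s + 1" if f: "f \<in> A" for f
  proof -
    obtain g where g: "g \<in> V" "q g < 1" "f = (\<lambda>x. complex_of_real (s + 1) * g x)"
      using s(2)[of "s + 1"] f by auto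
    have "q f = (s + 1) * q g"
      using seminorm_on_cmult[OF seminorms[OF q] g(1), of "complex_of_real (s + 1)"] s(1) g(3)
      by (simp del: of_real_add)
    also have "\<dots> \<le> (s + 1) * 1"
      using g(2) s(1) by (intro mult_left_mono) auto
    finally show ?thesis by simp
  qed
  then show "\<exists>C. \<forall>f\<in>A. q f \<le> C"
    by blast
next
  assume A: "A \<subseteq> V \<and> (\<forall>q\<in>Q. \<exists>C. \<forall>f\<in>A. q f \<le> C)"
  show "tvs_bounded T A"
    unfolding tvs_bounded_def
  proof (intro conjI allI impI)
    show "A \<subseteq> topspace T"
      using A by (simp add: topspace_seminorm_topology)
    fix U assume U: "openin T U \<and> (\<lambda>_. 0) \<in> U"
    obtain Q' e where Q': "finite Q'" "Q' \<subseteq> Q" "e > 0" "{g \<in> V. \<forall>q\<in>Q'. q g < e} \<subseteq> U"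
      using openin_contains_balls[of U "\<lambda>_. 0"] U by (simp only: diff_zero) blast
    obtain C where C: "\<And>q f. q \<in> Q' \<Longrightarrow> f \<in> A \<Longrightarrow> q f \<le> C q"
      using A Q'(2) by (metis subsetD)
    \<comment> \<open>The sum dominates each of the finitely many bounds \<open>C q\<close>; adding
      1 keeps \<open>s\<close> positive even if all of them vanish.\<close>
    define s where "s = (\<Sum>q\<in>Q'. \<bar>C q\<bar>) / e + 1"
    have s: "s > 0"
      using Q'(3) by (simp add: s_def add_nonneg_pos sum_nonneg)
    have "A \<subseteq> (\<lambda>f x. complex_of_real t * f x) ` U" if t: "t > s" for t
    proof
      fix f assume f: "f \<in> A"
      have fV: "f \<in> V"
        using A f by blast
      let ?g = "\<lambda>x. complex_of_real (1 / t) * f x"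
      have "q ?g < e" if q: "q \<in> Q'" for q
      proof -
        have "q ?g = q f / t"
          using seminorm_on_cmult[OF seminorms fV, of q "complex_of_real (1 / t)"] q Q'(2) s t by (auto simp: norm_divide)
        also have "\<dots> \<le> \<bar>C q\<bar> / t"
          using C[OF q f] s t by (intro divide_right_mono) auto
        also have "\<dots> \<le> (\<Sum>q\<in>Q'. \<bar>C q\<bar>) / t"
          using s t q Q'(1) by (intro divide_right_mono member_le_sum) auto
        also have "\<dots> < e"
        proof -
          have "(\<Sum>q\<in>Q'. \<bar>C q\<bar>) / e < t"
            using t by (simp add: s_def)
          then show ?thesis
            using s t Q'(3) by (simp add: field_simps)
        qed
        finally show ?thesis .
      qed
      moreover have "?g \<in> V"
        by (rule function_space_cmult[OF V fV])
      ultimately have "?g \<in> U"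
        using Q'(4) by blast
      moreover have "f = (\<lambda>x. complex_of_real t * ?g x)"
        using s t by (auto simp: fun_eq_iff)
      ultimately show "f \<in> (\<lambda>f x. complex_of_real t * f x) ` U"
        by (intro image_eqI[where x = ?g])
    qed
    with s show "\<exists>s>0. \<forall>t>s. A \<subseteq> (\<lambda>f x. complex_of_real t * f x) ` U"
      by blast
  qed
qed

text \<open>Finiteness is again what matters: the eventual conditions for the finitely many
  seminorms of a neighbourhood can be intersected. The terms must lie in \<open>V\<close> because
  the balls are subsets of \<open>V\<close>.\<close>

lemma limitin_iff:
  assumes "\<And>n. u n \<in> V"
  shows "limitin T u l sequentially \<longleftrightarrow> l \<in> V \<and> (\<forall>q\<in>Q. (\<lambda>n. q (\<lambda>x. u n x - l x)) \<longlonglongrightarrow> 0)"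
proof (intro iffI conjI ballI)
  assume lim: "limitin T u l sequentially"
  then show l: "l \<in> V"
    by (simp add: limitin_def topspace_seminorm_topology)
  fix q assume q: "q \<in> Q"
  show "(\<lambda>n. q (\<lambda>x. u n x - l x)) \<longlonglongrightarrow> 0"
  proof (rule order_tendstoI)
    fix e :: real assume "e < 0"
    then show "\<forall>\<^sub>F n in sequentially. e < q (\<lambda>x. u n x - l x)"
      by (intro always_eventually allI less_le_trans[OF _ seminorm_on_nonneg[OF seminorms[OF q] function_space_diff[OF V assms l]]])
  next
    fix e :: real assume "0 < e"
    then have "openin T {g \<in> V. q (\<lambda>x. g x - l x) < e}" "l \<in> {g \<in> V. q (\<lambda>x. g x - l x) < e}"
      using openin_ball[OF q l] l seminorm_zero[OF q] by simp_all
    then have "\<forall>\<^sub>F n in sequentially. u n \<in> {g \<in> V. q (\<lambda>x. g x - l x) < e}"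
      using lim unfolding limitin_def by blast
    then show "\<forall>\<^sub>F n in sequentially. q (\<lambda>x. u n x - l x) < e"
      by (rule eventually_mono) simp
  qed
next
  assume lim: "l \<in> V \<and> (\<forall>q\<in>Q. (\<lambda>n. q (\<lambda>x. u n x - l x)) \<longlonglongrightarrow> 0)"
  show "limitin T u l sequentially"
    unfolding limitin_def topspace_seminorm_topology
  proof (intro conjI allI impI)
    show "l \<in> V" using lim by blast
    fix U assume U: "openin T U \<and> l \<in> U"
    obtain Q' e where Q': "finite Q'" "Q' \<subseteq> Q" "e > 0" "{g \<in> V. \<forall>q\<in>Q'. q (\<lambda>x. g x - l x) < e} \<subseteq> U"
      by (rule openin_contains_balls[of U l]) (use U in auto)
    have "\<forall>\<^sub>F n in sequentially. \<forall>q\<in>Q'. q (\<lambda>x. u n x - l x) < e"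
    proof (rule eventually_ball_finite[OF Q'(1)], rule ballI)
      fix q assume "q \<in> Q'"
      then have "(\<lambda>n. q (\<lambda>x. u n x - l x)) \<longlonglongrightarrow> 0"
        using lim Q'(2) by blast
      then show "\<forall>\<^sub>F n in sequentially. q (\<lambda>x. u n x - l x) < e"
        using Q'(3) by (rule order_tendstoD)
    qed
    then show "\<forall>\<^sub>F n in sequentially. u n \<in> U"
    proof (rule eventually_mono)
      fix n assume "\<forall>q\<in>Q'. q (\<lambda>x. u n x - l x) < e"
      then have "u n \<in> {g \<in> V. \<forall>q\<in>Q'. q (\<lambda>x. g x - l x) < e}"
        using assms by simp
      with Q'(4) show "u n \<in> U" by (rule subsetD)
    qed
  qed
qed

section \<open>Continuous functionals, and the dual as a seminormed space\<close>

lemma topological_dual_bound: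
  assumes F: "F \<in> topological_dual V T"
  obtains Q' C where "finite Q'" "Q' \<subseteq> Q" "C \<ge> 0" "\<And>f. f \<in> V \<Longrightarrow> cmod (F f) \<le> C * (\<Sum>q\<in>Q'. q f)"
proof -
  have lin: "F (\<lambda>x. a * f x + b * g x) = a * F f + b * F g" if "f \<in> V" "g \<in> V" for f g a b
    using F that by (simp add: topological_dual_def)
  have scale: "F (\<lambda>x. a * f x) = a * F f" if "f \<in> V" for f a
    using lin[of f f a 0] that by simp
  \<comment> \<open>By continuity at 0, \<open>F\<close> maps some ball of radius \<open>e\<close>
    for finitely many seminorms into the unit disc; homogeneity turns this into a bound with
    constant \<open>1 / e\<close>.\<close>
  let ?U = "{f \<in> topspace T. F f \<in> ball 0 1}"
  have "openin T ?U"
    by (rule openin_continuous_map_preimage[of _ euclidean]) (use F in \<open>auto simp: topological_dual_def\<close>)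
  moreover have "(\<lambda>_. 0) \<in> ?U"
    using function_space_zero[OF V] scale[of "\<lambda>_. 0" 0] by (simp add: topspace_seminorm_topology)
  ultimately obtain Q' e where Q': "finite Q'" "Q' \<subseteq> Q" "e > 0" "{g \<in> V. \<forall>q\<in>Q'. q g < e} \<subseteq> ?U"
    using openin_contains_balls[of ?U "\<lambda>_. 0"] by (simp only: diff_zero) blast
  have "cmod (F f) \<le> 1 / e * (\<Sum>q\<in>Q'. q f)" if f: "f \<in> V" for f
  \<comment> \<open>Comparing with every \<open>t\<close> strictly above the claimed bound gives a
    positive divisor even where all the seminorms vanish at \<open>f\<close>.\<close>
  proof (rule dense_ge)
    fix t assume t: "1 / e * (\<Sum>q\<in>Q'. q f) < t"
    have nonneg: "0 \<le> q f" if "q \<in> Q'" for q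
      using seminorm_on_nonneg[OF seminorms f] that Q'(2) by blast
    have "0 \<le> 1 / e * (\<Sum>q\<in>Q'. q f)"
      using nonneg Q'(3) by (intro mult_nonneg_nonneg sum_nonneg) auto
    with t have "t > 0"
      by linarith
    let ?g = "\<lambda>x. complex_of_real (1 / t) * f x"
    have "q ?g < e" if q: "q \<in> Q'" for q
    proof -
      have "q ?g = q f / t"
        using seminorm_on_cmult[OF seminorms f, of q "complex_of_real (1 / t)"] q Q'(2) \<open>t > 0\<close> by (auto simp: norm_divide)
      also have "\<dots> \<le> (\<Sum>q\<in>Q'. q f) / t"
        using \<open>t > 0\<close> q Q'(1) nonneg by (intro divide_right_mono member_le_sum) auto
      also have "\<dots> < e"
        using t \<open>t > 0\<close> Q'(3) by (simp add: field_simps)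
      finally show ?thesis .
    qed
    then have "?g \<in> ?U"
      using Q'(4) function_space_cmult[OF V f] by blast
    then have "cmod (complex_of_real (1 / t) * F f) < 1"
      using scale[OF f, of "complex_of_real (1 / t)"] by simp
    with \<open>t > 0\<close> show "cmod (F f) \<le> t"
      by (simp add: norm_mult norm_divide field_simps)
  qed
  with Q' that[of Q' "1 / e"] show thesis
    by simp
qed

text \<open>Linearity carries the estimate at 0 to every point: \<open>F\<close> varies by less than
  \<open>e\<close> on a ball whose radius is \<open>e\<close> divided by a constant, so preimages of
  open sets are open. A bound by one seminorm of the family suffices.\<close>

lemma topological_dualI:
  assumes lin: "\<And>f g a b. f \<in> V \<Longrightarrow> g \<in> V \<Longrightarrow> F (\<lambda>x. a * f x + b * g x) = a * F f + b * F g"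
    and off: "\<And>f. f \<notin> V \<Longrightarrow> F f = 0"
    and q: "q \<in> Q" and bound: "\<And>f. f \<in> V \<Longrightarrow> cmod (F f) \<le> C * q f"
  shows "F \<in> topological_dual V T"
proof -
  have "openin T {f \<in> V. F f \<in> W}" if W: "open W" for W
  proof (subst openin_subopen, rule ballI)
    fix f assume f: "f \<in> {f \<in> V. F f \<in> W}"
    then obtain e where e: "e > 0" "ball (F f) e \<subseteq> W"
      using W by (auto simp: open_contains_ball)
    \<comment> \<open>The divisor is positive whatever the sign of \<open>C\<close>, and it still
      dominates \<open>C\<close>.\<close>
    define d where "d = e / (\<bar>C\<bar> + 1)"
    have d: "d > 0"
      using e(1) by (simp add: d_def)
    have "F g \<in> W" if g: "g \<in> V" "q (\<lambda>x. g x - f x) < d" for g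
    proof -
      have fg: "(\<lambda>x. g x - f x) \<in> V"
        using f g by (intro function_space_diff[OF V]) auto
      have "cmod (F g - F f) = cmod (F (\<lambda>x. g x - f x))"
        using lin[of g f 1 "-1"] f g by simp
      also have "\<dots> \<le> C * q (\<lambda>x. g x - f x)"
        by (rule bound[OF fg])
      also have "\<dots> \<le> (\<bar>C\<bar> + 1) * q (\<lambda>x. g x - f x)"
        by (intro mult_right_mono seminorm_on_nonneg[OF seminorms[OF q] fg]) auto
      also have "\<dots> < (\<bar>C\<bar> + 1) * d"
        using g by (intro mult_strict_left_mono) auto
      finally have "F g \<in> ball (F f) e"
        by (simp add: d_def dist_norm norm_minus_commute)
      then show ?thesis
        using e by blast
    qed
    then show "\<exists>S. openin T S \<and> f \<in> S \<and> S \<subseteq> {f \<in> V. F f \<in> W}"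
      using openin_ball[OF q, of f d] d f seminorm_zero[OF q]
      by (intro exI[of _ "{g \<in> V. q (\<lambda>x. g x - f x) < d}"]) auto
  qed
  then show ?thesis
    using lin off by (auto simp: topological_dual_def continuous_map_def topspace_seminorm_topology)
qed

lemma function_space_topological_dual: "function_space (topological_dual V T)"
proof -
  have "(\<lambda>_. 0) \<in> topological_dual V T"
    by (simp add: topological_dual_def)
  moreover have "(\<lambda>f. a * F f + b * G f) \<in> topological_dual V T"
    if FG: "F \<in> topological_dual V T" "G \<in> topological_dual V T" for F G a b
  proof -
    have scale: "continuous_map T euclidean (\<lambda>f. c * H f)" if "continuous_map T euclidean H" for H :: "_ \<Rightarrow> complex" and c
      using continuous_map_compose[OF that, of euclidean "\<lambda>z. c * z"]
      by (simp add: comp_def continuous_on_mult_left)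
    show ?thesis
      using FG by (auto simp: topological_dual_def algebra_simps intro!: continuous_map_add scale)
  qed
  ultimately show ?thesis
    by (auto simp: function_space_def)
qed

text \<open>The suprema defining the strong seminorms are taken in the reals and behave as suprema
  only for sets bounded above; this lemma provides that bound. It holds because \<open>F\<close> is
  dominated by finitely many seminorms, each of them bounded on \<open>B\<close>.\<close>

lemma topological_dual_bounded_on:
  assumes F: "F \<in> topological_dual V T" and B: "tvs_bounded T B"
  shows "bdd_above ((\<lambda>f. cmod (F f)) ` B)"
proof -
  obtain Q' C where Q': "finite Q'" "Q' \<subseteq> Q" "C \<ge> 0" "\<And>f. f \<in> V \<Longrightarrow> cmod (F f) \<le> C * (\<Sum>q\<in>Q'. q f)"
    using topological_dual_bound[OF F] by blast
  obtain D where D: "\<And>q f. q \<in> Q' \<Longrightarrow> f \<in> B \<Longrightarrow> q f \<le> D q"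
    using B Q'(2) unfolding tvs_bounded_iff by (metis subsetD)
  have "cmod (F f) \<le> C * (\<Sum>q\<in>Q'. D q)" if "f \<in> B" for f
  proof -
    have "cmod (F f) \<le> C * (\<Sum>q\<in>Q'. q f)"
      using Q'(4) B that by (auto simp: tvs_bounded_iff)
    also have "\<dots> \<le> C * (\<Sum>q\<in>Q'. D q)"
      using D that Q'(3) by (intro mult_left_mono sum_mono) auto
    finally show ?thesis .
  qed
  then show ?thesis
    by (intro bdd_aboveI2)
qed

lemma weak_dual_seminormed_space: "seminormed_space (topological_dual V T) {\<lambda>F. cmod (F f) | f. f \<in> V}"
  by unfold_locales
    (use function_space_topological_dual function_space_zero[OF V] in
      \<open>auto simp: seminorm_on_def norm_mult norm_triangle_ineq\<close>)

lemma tvs_bounded_singleton: "f \<in> V \<Longrightarrow> tvs_bounded T {f}"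
  by (auto simp: tvs_bounded_iff)

lemma strong_dual_seminormed_space:
  "seminormed_space (topological_dual V T) {\<lambda>F. SUP f\<in>B. cmod (F f) | B. tvs_bounded T B \<and> B \<noteq> {}}"
proof
  show "function_space (topological_dual V T)"
    by (rule function_space_topological_dual)
  show "{\<lambda>F. SUP f\<in>B. cmod (F f) | B. tvs_bounded T B \<and> B \<noteq> {}} \<noteq> {}"
    using tvs_bounded_singleton[OF function_space_zero[OF V]]
    by (simp, intro exI[of _ "{\<lambda>_. 0}"]) simp
  fix q assume "q \<in> {\<lambda>F. SUP f\<in>B. cmod (F f) | B. tvs_bounded T B \<and> B \<noteq> {}}"
  then obtain B where q: "q = (\<lambda>F. SUP f\<in>B. cmod (F f))" and B: "tvs_bounded T B" "B \<noteq> {}"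
    by blast
  note bdd = topological_dual_bounded_on[OF _ B(1)]
  show "seminorm_on (topological_dual V T) q"
    unfolding seminorm_on_def
  proof (intro conjI ballI allI)
    fix F assume F: "F \<in> topological_dual V T"
    show "0 \<le> q F"
    proof -
      obtain f where "f \<in> B"
        using B(2) by blast
      then show ?thesis
        unfolding q by (rule cSUP_upper2[OF bdd[OF F]]) simp
    qed
    fix G assume G: "G \<in> topological_dual V T"
    show "q (\<lambda>x. F x + G x) \<le> q F + q G"
      unfolding q
    proof (rule cSUP_least[OF B(2)])
      fix f assume f: "f \<in> B"
      show "cmod (F f + G f) \<le> (SUP f\<in>B. cmod (F f)) + (SUP f\<in>B. cmod (G f))"
        by (rule order_trans[OF norm_triangle_ineq add_mono[OF cSUP_upper[OF f bdd[OF F]] cSUP_upper[OF f bdd[OF G]]]])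
    qed
  next
    fix F c assume F: "F \<in> topological_dual V T"
    \<comment> \<open>A nonnegative factor passes through the supremum because multiplication by it
      is monotone and continuous.\<close>
    have "cmod c * (SUP f\<in>B. cmod (F f)) = (SUP y\<in>(\<lambda>f. cmod (F f)) ` B. cmod c * y)"
    proof (rule continuous_at_Sup_mono)
      show "mono (\<lambda>y. cmod c * y)"
        by (rule monoI) (rule mult_left_mono, simp_all)
      show "continuous (at_left (SUP f\<in>B. cmod (F f))) (\<lambda>y. cmod c * y)"
        by (intro continuous_intros)
      show "bdd_above ((\<lambda>f. cmod (F f)) ` B)"
        by (rule bdd[OF F])
    qed (use B in simp)
    then show "q (\<lambda>x. c * F x) = cmod c * q F"
      by (simp add: q norm_mult image_image)
  qed
qed

end

section \<open>Auxiliary estimates\<close>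

lemma borel_measurable_cnj [measurable (raw)]:
  fixes f :: "'a \<Rightarrow> complex"
  assumes "f \<in> borel_measurable N"
  shows "(\<lambda>x. cnj (f x)) \<in> borel_measurable N"
  by (rule borel_measurable_continuous_on[OF _ assms]) (intro continuous_intros)

lemma integrable_mult_of_square_integrable:
  fixes f g :: "'a \<Rightarrow> 'b::{real_normed_algebra, banach, second_countable_topology}"
  assumes [measurable]: "f \<in> borel_measurable N" "g \<in> borel_measurable N"
    and "integrable N (\<lambda>x. (norm (f x))\<^sup>2)" "integrable N (\<lambda>x. (norm (g x))\<^sup>2)"
  shows "integrable N (\<lambda>x. f x * g x)"
proof (rule Bochner_Integration.integrable_bound)
  show "integrable N (\<lambda>x. (norm (f x))\<^sup>2 + (norm (g x))\<^sup>2)"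
    using assms by simp
  show "AE x in N. norm (f x * g x) \<le> norm ((norm (f x))\<^sup>2 + (norm (g x))\<^sup>2)"
  proof (rule AE_I2)
    fix x
    have "norm (f x * g x) \<le> norm (f x) * norm (g x)"
      by (rule norm_mult_ineq)
    also have "\<dots> \<le> (norm (f x))\<^sup>2 + (norm (g x))\<^sup>2"
    proof -
      have "0 \<le> (norm (f x) - norm (g x))\<^sup>2" "0 \<le> (norm (f x))\<^sup>2 + (norm (g x))\<^sup>2"
        by simp_all
      then show ?thesis
        unfolding power2_diff by linarith
    qed
    finally show "norm (f x * g x) \<le> norm ((norm (f x))\<^sup>2 + (norm (g x))\<^sup>2)"
      by simp
  qed
qed measurable

lemma L2_set_le_sqrt_infsum:
  assumes "(\<lambda>x. (f x)\<^sup>2) summable_on A" "finite B" "B \<subseteq> A"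
  shows "L2_set f B \<le> sqrt (\<Sum>\<^sub>\<infinity>x\<in>A. (f x)\<^sup>2)"
  unfolding L2_set_def using assms by (intro real_sqrt_le_mono finite_sum_le_infsum) auto

lemma L2_set_bounded_imp_summable:
  assumes "\<And>B. finite B \<Longrightarrow> B \<subseteq> A \<Longrightarrow> L2_set f B \<le> K"
  shows "(\<lambda>x. (f x)\<^sup>2) summable_on A" "sqrt (\<Sum>\<^sub>\<infinity>x\<in>A. (f x)\<^sup>2) \<le> K"
proof -
  have K: "K \<ge> 0"
    using assms[of "{}"] by simp
  have sum_le: "(\<Sum>x\<in>B. (f x)\<^sup>2) \<le> K\<^sup>2" if "finite B" "B \<subseteq> A" for B
    using assms[OF that] by (simp add: L2_set_def sqrt_le_D)
  then show summable: "(\<lambda>x. (f x)\<^sup>2) summable_on A"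
    by (intro nonneg_bdd_above_summable_on bdd_aboveI2[where M = "K\<^sup>2"]) auto
  show "sqrt (\<Sum>\<^sub>\<infinity>x\<in>A. (f x)\<^sup>2) \<le> K"
    using infsum_le_finite_sums[OF summable sum_le] K by (simp add: real_le_lsqrt infsum_nonneg)
qed

text \<open>The sets \<open>Pow {0..n}\<close> are cofinal among the finite subsets of
  \<open>Gam\<close>: the union of finitely many finite sets has an upper bound. Unordered sums over
  \<open>Gam\<close> are therefore limits along the order in which a generalized martingale exhausts
  the index sets.\<close>

lemma filterlim_Pow_finite_subsets_at_top:
  "filterlim (\<lambda>n. Pow {0..n}) (finite_subsets_at_top Gam) sequentially"
  unfolding filterlim_finite_subsets_at_top
proof (intro allI impI)
  fix X :: "nat set set" assume X: "finite X \<and> X \<subseteq> Gam"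
  then have "finite (\<Union>X)"
    by blast
  then obtain m where m: "\<forall>k\<in>\<Union>X. k \<le> m"
    unfolding finite_nat_set_iff_bounded_le ..
  have "X \<subseteq> Pow {0..n}" if "n \<ge> m" for n
  proof (intro subsetI PowI)
    fix \<sigma> k assume "\<sigma> \<in> X" "k \<in> \<sigma>"
    with m have "k \<le> m" by blast
    with that show "k \<in> {0..n}" by simp
  qed
  then show "\<forall>\<^sub>F n in sequentially. finite (Pow {0..n}) \<and> X \<subseteq> Pow {0..n} \<and> Pow {0..n} \<subseteq> Gam"
    by (intro eventually_sequentiallyI[of m]) (auto intro: finite_subset)
qed

lemma lam_ge_1: "1 \<le> lam \<sigma>"
  unfolding lam_def by (intro prod_ge_1) auto

text \<open>The difference of the two sides is a multiple of a sum of squares. It lets summability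
  of \<open>4 ^ k * t\<^sup>2\<close> force absolute summability of the terms themselves.\<close>

lemma le_quarter_power_plus: "(t::real) \<le> (1 / 4) ^ k + 4 ^ k * t\<^sup>2"
proof -
  have "0 \<le> (1 / 4) ^ k * ((4 ^ k * t - 1)\<^sup>2 + 1 + (4 ^ k * t)\<^sup>2) / 2"
    by (intro divide_nonneg_nonneg mult_nonneg_nonneg) auto
  also have "\<dots> = (1 / 4) ^ k - t + 4 ^ k * t\<^sup>2"
    by (simp add: power2_eq_square field_simps)
  finally show ?thesis
    by simp
qed

text \<open>Cauchy-Schwarz after writing each term as \<open>(1 / 2) ^ k\<close> times
  \<open>2 ^ k * t k\<close>. The factor 2 is a convenient upper bound for the geometric sum 4/3,
  and it does not depend on \<open>n\<close>.\<close>

lemma sum_square_le_weighted: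
  fixes t :: "nat \<Rightarrow> real"
  shows "(\<Sum>k<n. t k)\<^sup>2 \<le> 2 * (\<Sum>k<n. 4 ^ k * (t k)\<^sup>2)"
proof -
  have four: "((2::real) ^ k)\<^sup>2 = 4 ^ k" for k
    by (simp add: power2_eq_square flip: power_mult_distrib)
  have "(\<Sum>k<n. t k)\<^sup>2 = (\<Sum>k<n. (1 / 2) ^ k * (2 ^ k * t k))\<^sup>2"
    by (simp add: power_divide)
  also have "\<dots> \<le> (\<Sum>k<n. ((1 / 2) ^ k)\<^sup>2) * (\<Sum>k<n. (2 ^ k * t k)\<^sup>2)"
    by (rule Cauchy_Schwarz_ineq_sum)
  also have "(\<Sum>k<n. (2 ^ k * t k)\<^sup>2) = (\<Sum>k<n. 4 ^ k * (t k)\<^sup>2)"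
    by (simp add: power_mult_distrib four)
  also have "(\<Sum>k<n. ((1 / 2) ^ k)\<^sup>2) = (\<Sum>k<n. (1 / 4 :: real) ^ k)"
    by (simp add: power2_eq_square flip: power_mult_distrib)
  also have "\<dots> * (\<Sum>k<n. 4 ^ k * (t k)\<^sup>2) \<le> 2 * (\<Sum>k<n. 4 ^ k * (t k)\<^sup>2)"
  proof (rule mult_right_mono)
    have "(\<Sum>k<n. (1 / 4 :: real) ^ k) \<le> (\<Sum>k. (1 / 4) ^ k)"
      by (intro sum_le_suminf summable_geometric) auto
    then show "(\<Sum>k<n. (1 / 4 :: real) ^ k) \<le> 2"
      by (simp add: suminf_geometric)
  qed (simp add: sum_nonneg)
  finally show ?thesis .
qed

section \<open>Orthonormality of the products of the noise\<close>

locale discrete_normal_martingale =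
  fixes P :: "'a measure" and M :: "nat \<Rightarrow> 'a \<Rightarrow> real"
  assumes normal: "normal_martingale P M"
begin

sublocale prob_space P
  using normal by (simp add: normal_martingale_def)

section \<open>The filtration and the conditional moments of the noise\<close>

abbreviation past :: "nat \<Rightarrow> 'a measure" where
  "past n \<equiv> generated_algebra P M {..<n}"

abbreviation Z :: "nat \<Rightarrow> 'a \<Rightarrow> real" where
  "Z \<equiv> normal_noise M"

text \<open>The real version of \<open>Zprod\<close>, kept separate because the conditional
  expectations used here are those of real functions.\<close>

definition Zreal :: "nat set \<Rightarrow> 'a \<Rightarrow> real" where
  "Zreal \<sigma> x = (\<Prod>i\<in>\<sigma>. Z i x)"

lemma Zprod_eq: "Zprod M \<sigma> x = complex_of_real (Zreal \<sigma> x)"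
  by (simp add: Zprod_def Zreal_def)

lemma M_measurable [measurable]: "M n \<in> borel_measurable P"
  using normal by (simp add: normal_martingale_def)

lemma M_square_integrable: "integrable P (\<lambda>x. (M n x)\<^sup>2)"
  using normal by (simp add: normal_martingale_def)

lemma M_mult_integrable: "integrable P (\<lambda>x. M m x * M n x)"
  using M_square_integrable by (intro integrable_mult_of_square_integrable) simp_all

lemma M_integrable: "integrable P (M n)"
  using integrable_mult_of_square_integrable[of "\<lambda>_. 1" P "M n"] M_square_integrable by simp

lemma space_generated_algebra: "space (generated_algebra P M I) = space P"
  by (simp add: generated_algebra_def space_measure_of_conv)

lemma subalgebra_generated_algebra: "subalgebra P (generated_algebra P M I)"
proof -
  have "{M k -` A \<inter> space P | k A. k \<in> I \<and> A \<in> sets borel} \<subseteq> sets P"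
    by auto
  then have "sets (generated_algebra P M I) \<subseteq> sets P"
    unfolding generated_algebra_def by (subst sets_measure_of) (auto intro!: sets.sigma_sets_subset)
  then show ?thesis
    by (simp add: subalgebra_def space_generated_algebra)
qed

lemma measurable_generated_algebra:
  "k \<in> I \<Longrightarrow> M k \<in> borel_measurable (generated_algebra P M I)"
  unfolding generated_algebra_def
  by (rule measurableI) (auto simp: space_measure_of_conv intro!: in_measure_of)

lemma Z_measurable_generated_algebra:
  assumes "{..n} \<subseteq> I"
  shows "Z n \<in> borel_measurable (generated_algebra P M I)"
proof -
  have "M n \<in> borel_measurable (generated_algebra P M I)"
    "M (n - 1) \<in> borel_measurable (generated_algebra P M I)"
    using assms by (auto intro!: measurable_generated_algebra)
  then show ?thesis
    by (cases n) (auto simp: normal_noise_def[abs_def])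
qed

lemma Zreal_measurable_generated_algebra:
  assumes "\<And>n. n \<in> \<sigma> \<Longrightarrow> {..n} \<subseteq> I"
  shows "Zreal \<sigma> \<in> borel_measurable (generated_algebra P M I)"
  unfolding Zreal_def[abs_def]
  by (intro borel_measurable_prod Z_measurable_generated_algebra assms)

lemma Z_measurable [measurable]: "Z n \<in> borel_measurable P"
  by (rule measurable_from_subalg[OF subalgebra_generated_algebra Z_measurable_generated_algebra[OF subset_UNIV]])

lemma Zreal_measurable [measurable]: "Zreal \<sigma> \<in> borel_measurable P"
  unfolding Zreal_def[abs_def] by measurable

lemma sigma_finite_past: "sigma_finite_subalgebra P (past n)"
  by (rule finite_measure_subalgebra_is_sigma_finite)
    (simp add: finite_measure_subalgebra_def finite_measure_subalgebra_axioms_def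
      finite_measure_axioms subalgebra_generated_algebra)

lemma cond_exp_Z: "AE x in P. real_cond_exp P (past n) (Z n) x = 0"
proof (cases n)
  case 0
  then show ?thesis
    using normal by (simp add: normal_martingale_def normal_noise_def[abs_def])
next
  case (Suc m)
  interpret sigma_finite_subalgebra P "past n"
    by (rule sigma_finite_past)
  have "AE x in P. real_cond_exp P (past n) (\<lambda>x. M n x - M m x) x =
      real_cond_exp P (past n) (M n) x - real_cond_exp P (past n) (M m) x"
    by (rule real_cond_exp_diff) (auto simp: M_integrable)
  moreover have "AE x in P. real_cond_exp P (past n) (M m) x = M m x"
    by (rule real_cond_exp_F_meas) (auto simp: M_integrable Suc intro!: measurable_generated_algebra)
  moreover have "AE x in P. real_cond_exp P (past n) (M n) x = M m x"
    using normal Suc by (auto simp: normal_martingale_def dest: spec[of _ n])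
  ultimately show ?thesis
    by (auto simp: Suc normal_noise_def[abs_def])
qed

text \<open>For \<open>n = Suc m\<close>, expand the square of \<open>M n - M m\<close>. Given the
  past, the cross term \<open>2 * M m * M n\<close> has conditional expectation twice the square of
  \<open>M m\<close>, so what remains of \<open>(M m)\<^sup>2 + 1\<close> is 1.\<close>

lemma cond_exp_Z_square: "AE x in P. real_cond_exp P (past n) (\<lambda>x. (Z n x)\<^sup>2) x = 1"
proof (cases n)
  case 0
  then show ?thesis
    using normal by (simp add: normal_martingale_def normal_noise_def[abs_def])
next
  case (Suc m)
  interpret sigma_finite_subalgebra P "past n"
    by (rule sigma_finite_past)
  have meas [measurable]: "M m \<in> borel_measurable (past n)"
    by (rule measurable_generated_algebra) (simp add: Suc)
  let ?f = "\<lambda>x. (M n x)\<^sup>2 - (2 * M m x) * M n x" and ?g = "\<lambda>x. (M m x)\<^sup>2"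
  have int: "integrable P (\<lambda>x. (2 * M m x) * M n x)"
    using M_mult_integrable[of m n] by (simp add: mult.assoc)
  have "AE x in P. real_cond_exp P (past n) (\<lambda>x. ?f x + ?g x) x =
      real_cond_exp P (past n) ?f x + real_cond_exp P (past n) ?g x"
    by (rule real_cond_exp_add) (auto simp: M_square_integrable int)
  moreover have "AE x in P. real_cond_exp P (past n) ?f x =
      real_cond_exp P (past n) (\<lambda>x. (M n x)\<^sup>2) x - real_cond_exp P (past n) (\<lambda>x. (2 * M m x) * M n x) x"
    by (rule real_cond_exp_diff) (auto simp: M_square_integrable int)
  moreover have "AE x in P. real_cond_exp P (past n) ?g x = ?g x"
    by (rule real_cond_exp_F_meas) (auto simp: M_square_integrable)
  moreover have "AE x in P. real_cond_exp P (past n) (\<lambda>x. (2 * M m x) * M n x) x =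
      (2 * M m x) * real_cond_exp P (past n) (M n) x"
    by (rule real_cond_exp_mult) (auto simp: int)
  moreover have "AE x in P. real_cond_exp P (past n) (M n) x = M m x"
    using normal Suc by (auto simp: normal_martingale_def dest: spec[of _ n])
  moreover have "AE x in P. real_cond_exp P (past n) (\<lambda>x. (M n x)\<^sup>2) x = (M m x)\<^sup>2 + 1"
    using normal Suc by (auto simp: normal_martingale_def dest: spec[of _ n])
  moreover have "(\<lambda>x. (Z n x)\<^sup>2) = (\<lambda>x. ?f x + ?g x)"
    by (auto simp: Suc normal_noise_def fun_eq_iff power2_eq_square algebra_simps)
  ultimately show ?thesis
    by (auto simp: power2_eq_square)
qed

section \<open>Moments of the products: norm one and orthogonality\<close>

lemma Zreal_insert: "finite \<sigma> \<Longrightarrow> n \<notin> \<sigma> \<Longrightarrow> Zreal (insert n \<sigma>) x = Z n x * Zreal \<sigma> x"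
  by (simp add: Zreal_def)

lemma Zreal_measurable_past:
  assumes "\<And>k. k \<in> \<sigma> \<Longrightarrow> k < n"
  shows "Zreal \<sigma> \<in> borel_measurable (past n)"
  by (rule Zreal_measurable_generated_algebra) (use assms in force)

text \<open>Nonnegative integrals are used because square integrability of products of several noise
  variables is not yet known; it is derived from this identity.\<close>

lemma nn_integral_mult_Z_square:
  assumes [measurable]: "f \<in> borel_measurable (past n)"
  shows "(\<integral>\<^sup>+x. f x * ennreal ((Z n x)\<^sup>2) \<partial>P) = (\<integral>\<^sup>+x. f x \<partial>P)"
proof -
  interpret sigma_finite_subalgebra P "past n"
    by (rule sigma_finite_past)
  \<comment> \<open>\<open>real_cond_exp\<close> is the difference of the conditional expectations
    of the positive and the negative part. The negative part of a square is 0, so only the first one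
    survives.\<close>
  have "AE x in P. nn_cond_exp P (past n) (\<lambda>_. 0) x = 0"
    using nn_cond_exp_F_meas[of "\<lambda>_. 0"] by simp
  then have "AE x in P. nn_cond_exp P (past n) (\<lambda>x. ennreal ((Z n x)\<^sup>2)) x = 1"
    using cond_exp_Z_square[of n]
  proof eventually_elim
    case (elim x)
    have "ennreal (- (Z n y)\<^sup>2) = 0" for y
      by (simp add: ennreal_neg)
    with elim have "enn2real (nn_cond_exp P (past n) (\<lambda>x. ennreal ((Z n x)\<^sup>2)) x) = 1"
      by (simp add: real_cond_exp_def)
    \<comment> \<open>\<open>enn2real\<close> maps infinity to 0, so the real value 1 can only come
      from the extended value 1.\<close>
    then show ?case
      by (metis ennreal_1 ennreal_enn2real_if enn2real_top zero_neq_one)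
  qed
  then have "(\<integral>\<^sup>+x. f x \<partial>P) = (\<integral>\<^sup>+x. f x * nn_cond_exp P (past n) (\<lambda>x. ennreal ((Z n x)\<^sup>2)) x \<partial>P)"
    by (intro nn_integral_cong_AE) (auto elim: eventually_mono)
  also have "\<dots> = (\<integral>\<^sup>+x. f x * ennreal ((Z n x)\<^sup>2) \<partial>P)"
    by (rule nn_cond_exp_intg) auto
  finally show ?thesis ..
qed

text \<open>The induction adds a new largest index \<open>n\<close>. The product over the smaller
  indices is measurable with respect to the past of \<open>n\<close>, so the square of the last
  factor integrates out.\<close>

lemma nn_integral_Zreal_square:
  "finite \<sigma> \<Longrightarrow> (\<integral>\<^sup>+x. ennreal ((Zreal \<sigma> x)\<^sup>2) \<partial>P) = 1"
proof (induction \<sigma> rule: finite_linorder_max_induct)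
  case empty
  then show ?case
    by (simp add: Zreal_def emeasure_space_1)
next
  case (insert n \<sigma>)
  have "n \<notin> \<sigma>"
    using insert.hyps by blast
  have [measurable]: "Zreal \<sigma> \<in> borel_measurable (past n)"
    using insert.hyps by (intro Zreal_measurable_past) blast
  have "(\<integral>\<^sup>+x. ennreal ((Zreal (insert n \<sigma>) x)\<^sup>2) \<partial>P) =
      (\<integral>\<^sup>+x. ennreal ((Zreal \<sigma> x)\<^sup>2) * ennreal ((Z n x)\<^sup>2) \<partial>P)"
    using insert.hyps \<open>n \<notin> \<sigma>\<close>
    by (simp add: Zreal_insert power_mult_distrib ennreal_mult[symmetric] mult.commute)
  also have "\<dots> = 1"
    by (subst nn_integral_mult_Z_square) (auto simp: insert.IH)
  finally show ?case .
qed

lemma Zreal_square_integrable: "finite \<sigma> \<Longrightarrow> integrable P (\<lambda>x. (Zreal \<sigma> x)\<^sup>2)"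
  by (rule integrableI_nonneg) (auto simp: nn_integral_Zreal_square)

lemma Zreal_mult_integrable:
  "finite \<sigma> \<Longrightarrow> finite \<tau> \<Longrightarrow> integrable P (\<lambda>x. Zreal \<sigma> x * Zreal \<tau> x)"
  by (intro integrable_mult_of_square_integrable) (simp_all add: Zreal_square_integrable)

lemma integral_Zreal_square: "finite \<sigma> \<Longrightarrow> (\<integral>x. (Zreal \<sigma> x)\<^sup>2 \<partial>P) = 1"
  by (subst integral_eq_nn_integral) (auto simp: nn_integral_Zreal_square)

lemma integral_mult_Z:
  assumes "f \<in> borel_measurable (past n)" "integrable P (\<lambda>x. f x * Z n x)"
  shows "(\<integral>x. f x * Z n x \<partial>P) = 0"
proof -
  interpret sigma_finite_subalgebra P "past n"
    by (rule sigma_finite_past)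
  have [measurable]: "f \<in> borel_measurable P"
    by (rule measurable_from_subalg[OF subalgebra_generated_algebra assms(1)])
  have "(\<integral>x. f x * Z n x \<partial>P) = (\<integral>x. f x * real_cond_exp P (past n) (Z n) x \<partial>P)"
    by (rule real_cond_exp_intg(2)[symmetric]) (use assms in auto)
  also have "\<dots> = (\<integral>x. 0 \<partial>P)"
    using cond_exp_Z[of n] by (intro integral_cong_AE) (auto elim: eventually_mono)
  finally show ?thesis
    by simp
qed

lemma integral_mult_Z_square:
  assumes "f \<in> borel_measurable (past n)" "integrable P (\<lambda>x. f x * (Z n x)\<^sup>2)"
  shows "(\<integral>x. f x * (Z n x)\<^sup>2 \<partial>P) = (\<integral>x. f x \<partial>P)"
proof -
  interpret sigma_finite_subalgebra P "past n"
    by (rule sigma_finite_past)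
  have [measurable]: "f \<in> borel_measurable P"
    by (rule measurable_from_subalg[OF subalgebra_generated_algebra assms(1)])
  have "(\<integral>x. f x * (Z n x)\<^sup>2 \<partial>P) = (\<integral>x. f x * real_cond_exp P (past n) (\<lambda>x. (Z n x)\<^sup>2) x \<partial>P)"
    by (rule real_cond_exp_intg(2)[symmetric]) (use assms in auto)
  also have "\<dots> = (\<integral>x. f x \<partial>P)"
    using cond_exp_Z_square[of n] by (intro integral_cong_AE) (auto elim: eventually_mono)
  finally show ?thesis .
qed

text \<open>Induction on the largest index \<open>n\<close> of a common superset. If
  \<open>n\<close> lies in both sets, its squared factor integrates out; if it lies in exactly one,
  the integral vanishes since \<open>Z n\<close> has conditional mean 0; if in neither, the
  induction hypothesis applies directly.\<close>

lemma integral_Zreal_mult_zero: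
  assumes "finite A" "\<sigma> \<subseteq> A" "\<tau> \<subseteq> A" "\<sigma> \<noteq> \<tau>"
  shows "(\<integral>x. Zreal \<sigma> x * Zreal \<tau> x \<partial>P) = 0"
  using assms
proof (induction A arbitrary: \<sigma> \<tau> rule: finite_linorder_max_induct)
  case (insert n A)
  have fin: "finite \<sigma>" "finite \<tau>"
    using insert.prems insert.hyps by (auto intro: finite_subset[of _ "insert n A"])
  have meas: "(\<lambda>x. Zreal \<alpha> x * Zreal \<beta> x) \<in> borel_measurable (past n)" if "\<alpha> \<subseteq> A" "\<beta> \<subseteq> A" for \<alpha> \<beta>
    using that insert.hyps by (intro borel_measurable_times Zreal_measurable_past) blast+
  have split: "Zreal \<alpha> x = Z n x * Zreal (\<alpha> - {n}) x" if "n \<in> \<alpha>" "finite \<alpha>" for \<alpha> x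
    using Zreal_insert[of "\<alpha> - {n}" n x] that by (simp add: insert_absorb)
  have sub: "\<sigma> - {n} \<subseteq> A" "\<tau> - {n} \<subseteq> A"
    using insert.prems by blast+
  have one_sided: "(\<integral>x. Zreal \<alpha> x * Zreal \<beta> x \<partial>P) = 0"
    if "n \<in> \<alpha>" "n \<notin> \<beta>" "\<alpha> - {n} \<subseteq> A" "\<beta> \<subseteq> A" "finite \<alpha>" "finite \<beta>" for \<alpha> \<beta>
  proof -
    have eq: "Zreal \<alpha> x * Zreal \<beta> x = (Zreal (\<alpha> - {n}) x * Zreal \<beta> x) * Z n x" for x
      by (simp add: split[OF that(1,5)])
    show ?thesis
      using integral_mult_Z[OF meas[OF that(3,4)]] Zreal_mult_integrable[OF that(5,6)]
      by (simp only: eq)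
  qed
  consider "n \<in> \<sigma>" "n \<in> \<tau>" | "n \<in> \<sigma>" "n \<notin> \<tau>" | "n \<notin> \<sigma>" "n \<in> \<tau>" | "n \<notin> \<sigma>" "n \<notin> \<tau>"
    by blast
  then show ?case
  proof cases
    case 1
    have eq: "Zreal \<sigma> x * Zreal \<tau> x = (Zreal (\<sigma> - {n}) x * Zreal (\<tau> - {n}) x) * (Z n x)\<^sup>2" for x
      by (simp add: split[OF 1(1) fin(1)] split[OF 1(2) fin(2)] power2_eq_square)
    have "(\<integral>x. Zreal \<sigma> x * Zreal \<tau> x \<partial>P) = (\<integral>x. Zreal (\<sigma> - {n}) x * Zreal (\<tau> - {n}) x \<partial>P)"
      using integral_mult_Z_square[OF meas[OF sub]] Zreal_mult_integrable[OF fin]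
      by (simp only: eq)
    \<comment> \<open>Since \<open>n\<close> lies in both sets, they still differ after its
      removal.\<close>
    also have "\<dots> = 0"
      using 1 insert.prems(3) by (intro insert.IH sub) blast
    finally show ?thesis .
  next
    case 2
    then show ?thesis
      using sub fin by (intro one_sided) auto
  next
    case 3
    then show ?thesis
      using sub fin one_sided[of \<tau> \<sigma>] by (simp add: mult.commute)
  next
    case 4
    then show ?thesis
      using insert.prems by (intro insert.IH) blast+
  qed
qed auto

lemma inner_Zprod:
  assumes "finite \<sigma>" "finite \<tau>"
  shows "L2_inner P (Zprod M \<sigma>) (Zprod M \<tau>) = (if \<sigma> = \<tau> then 1 else 0)"
proof -
  have "L2_inner P (Zprod M \<sigma>) (Zprod M \<tau>) = complex_of_real (\<integral>x. Zreal \<sigma> x * Zreal \<tau> x \<partial>P)"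
    by (simp add: L2_inner_def Zprod_eq flip: of_real_mult)
  also have "(\<integral>x. Zreal \<sigma> x * Zreal \<tau> x \<partial>P) = (if \<sigma> = \<tau> then 1 else 0)"
    using integral_Zreal_square[of \<sigma>] integral_Zreal_mult_zero[of "\<sigma> \<union> \<tau>" \<sigma> \<tau>] assms
    by (auto simp: power2_eq_square)
  finally show ?thesis
    by simp
qed

section \<open>Testing functionals\<close>

abbreviation coef :: "nat set \<Rightarrow> ('a \<Rightarrow> complex) \<Rightarrow> complex" where
  "coef \<sigma> \<equiv> L2_inner P (Zprod M \<sigma>)"

lemma L2_borel_measurable: "\<xi> \<in> L2 P M \<Longrightarrow> \<xi> \<in> borel_measurable P"
  by (rule L2_measurable[OF normal])

lemma L2_square_integrable: "\<xi> \<in> L2 P M \<Longrightarrow> integrable P (\<lambda>x. (cmod (\<xi> x))\<^sup>2)"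
  by (simp add: L2_def)

lemma function_space_L2: "function_space (L2 P M)"
  unfolding function_space_def
proof (intro conjI ballI allI)
  show "(\<lambda>_. 0) \<in> L2 P M"
    by (simp add: L2_def)
  fix f g and a b :: complex
  assume f: "f \<in> L2 P M" and g: "g \<in> L2 P M"
  have [measurable]: "f \<in> borel_measurable P" "g \<in> borel_measurable P"
    using f g by (auto intro: L2_borel_measurable)
  have "integrable P (\<lambda>x. (cmod (a * f x + b * g x))\<^sup>2)"
  proof (rule Bochner_Integration.integrable_bound)
    show "integrable P (\<lambda>x. 2 * (cmod a)\<^sup>2 * (cmod (f x))\<^sup>2 + 2 * (cmod b)\<^sup>2 * (cmod (g x))\<^sup>2)"
      using f g by (simp add: L2_square_integrable)
    show "AE x in P. norm ((cmod (a * f x + b * g x))\<^sup>2)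
        \<le> norm (2 * (cmod a)\<^sup>2 * (cmod (f x))\<^sup>2 + 2 * (cmod b)\<^sup>2 * (cmod (g x))\<^sup>2)"
    proof (rule AE_I2)
      fix x
      let ?u = "cmod a * cmod (f x)" and ?v = "cmod b * cmod (g x)"
      have "(cmod (a * f x + b * g x))\<^sup>2 \<le> (?u + ?v)\<^sup>2"
        by (intro power_mono) (auto simp: norm_mult[symmetric] intro: norm_triangle_ineq)
      also have "\<dots> \<le> 2 * ?u\<^sup>2 + 2 * ?v\<^sup>2"
        using zero_le_power2[of "?u - ?v"] unfolding power2_sum power2_diff by linarith
      finally show "norm ((cmod (a * f x + b * g x))\<^sup>2)
          \<le> norm (2 * (cmod a)\<^sup>2 * (cmod (f x))\<^sup>2 + 2 * (cmod b)\<^sup>2 * (cmod (g x))\<^sup>2)"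
        by (simp add: power_mult_distrib)
    qed
  qed measurable
  then show "(\<lambda>x. a * f x + b * g x) \<in> L2 P M"
    using f g by (auto simp: L2_def)
qed

lemma Zprod_L2:
  assumes "finite \<sigma>"
  shows "Zprod M \<sigma> \<in> L2 P M"
proof -
  have [measurable]: "Zreal \<sigma> \<in> borel_measurable (generated_algebra P M UNIV)"
    by (rule Zreal_measurable_generated_algebra) simp
  show ?thesis
    using Zreal_square_integrable[OF assms] by (simp add: L2_def Zprod_eq[abs_def])
qed

lemma L2_mult_integrable:
  assumes "\<xi> \<in> L2 P M" "\<eta> \<in> L2 P M"
  shows "integrable P (\<lambda>x. cnj (\<xi> x) * \<eta> x)"
  using assms L2_borel_measurable L2_square_integrable
  by (intro integrable_mult_of_square_integrable) (auto intro: borel_measurable_cnj)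

lemma L2_inner_lincomb:
  assumes "\<zeta> \<in> L2 P M" "\<xi> \<in> L2 P M" "\<eta> \<in> L2 P M"
  shows "L2_inner P \<zeta> (\<lambda>x. a * \<xi> x + b * \<eta> x) = a * L2_inner P \<zeta> \<xi> + b * L2_inner P \<zeta> \<eta>"
proof -
  have "L2_inner P \<zeta> (\<lambda>x. a * \<xi> x + b * \<eta> x) = (\<integral>x. a * (cnj (\<zeta> x) * \<xi> x) + b * (cnj (\<zeta> x) * \<eta> x) \<partial>P)"
    by (simp add: L2_inner_def algebra_simps)
  also have "\<dots> = a * L2_inner P \<zeta> \<xi> + b * L2_inner P \<zeta> \<eta>"
    using L2_mult_integrable[OF assms(1,2)] L2_mult_integrable[OF assms(1,3)]
    by (simp add: L2_inner_def)
  finally show ?thesis .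
qed

lemma L2_inner_zero: "L2_inner P \<zeta> (\<lambda>_. 0) = 0"
  by (simp add: L2_inner_def)

section \<open>Finite chaos expansions\<close>

definition Zsum :: "nat set set \<Rightarrow> (nat set \<Rightarrow> complex) \<Rightarrow> 'a \<Rightarrow> complex" where
  "Zsum A c x = (\<Sum>\<sigma>\<in>A. c \<sigma> * Zprod M \<sigma> x)"

lemma Zsum_L2: "A \<subseteq> Gam \<Longrightarrow> Zsum A c \<in> L2 P M"
  unfolding Zsum_def[abs_def]
  by (intro function_space_sum function_space_cmult function_space_L2 Zprod_L2) auto

text \<open>The factor 1 brings the sum into the shape of the two-term combinations for which
  linearity is stated.\<close>

lemma Zsum_insert:
  "finite A \<Longrightarrow> \<sigma> \<notin> A \<Longrightarrow> Zsum (insert \<sigma> A) c = (\<lambda>x. c \<sigma> * Zprod M \<sigma> x + 1 * Zsum A c x)"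
  by (simp add: Zsum_def fun_eq_iff)

lemma L2_inner_Zsum:
  assumes "finite A" "A \<subseteq> Gam" "\<zeta> \<in> L2 P M"
  shows "L2_inner P \<zeta> (Zsum A c) = (\<Sum>\<sigma>\<in>A. c \<sigma> * L2_inner P \<zeta> (Zprod M \<sigma>))"
  using assms(1,2)
proof (induction A)
  case empty
  then show ?case
    by (simp add: Zsum_def[abs_def] L2_inner_zero)
next
  case (insert \<sigma> A)
  then show ?case
    using L2_inner_lincomb[OF assms(3), of "Zprod M \<sigma>" "Zsum A c" "c \<sigma>" 1]
    by (simp add: Zsum_insert Zprod_L2 Zsum_L2)
qed

lemma coef_Zsum:
  assumes "finite A" "A \<subseteq> Gam" "finite \<tau>"
  shows "coef \<tau> (Zsum A c) = (if \<tau> \<in> A then c \<tau> else 0)"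
proof -
  have "coef \<tau> (Zsum A c) = (\<Sum>\<sigma>\<in>A. c \<sigma> * (if \<tau> = \<sigma> then 1 else 0))"
    unfolding L2_inner_Zsum[OF assms(1,2) Zprod_L2[OF assms(3)]]
    using assms by (intro sum.cong refl, subst inner_Zprod) blast+
  then show ?thesis
    using assms(1) by (simp add: if_distrib cong: if_cong)
qed

lemma L2_inner_commute: "L2_inner P \<xi> \<eta> = cnj (L2_inner P \<eta> \<xi>)"
proof -
  have "L2_inner P \<xi> \<eta> = (\<integral>x. cnj (cnj (\<eta> x) * \<xi> x) \<partial>P)"
    by (simp add: L2_inner_def mult.commute)
  then show ?thesis
    unfolding L2_inner_def Bochner_Integration.integral_cnj .
qed

text \<open>Pythagoras: expanding one argument of the inner product of \<open>Zsum A c\<close> with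
  itself leaves the coefficients of the other one, which orthonormality identifies as the
  \<open>c \<sigma>\<close>.\<close>

lemma integral_Zsum_square:
  assumes "finite A" "A \<subseteq> Gam"
  shows "(\<integral>x. (cmod (Zsum A c x))\<^sup>2 \<partial>P) = (\<Sum>\<sigma>\<in>A. (cmod (c \<sigma>))\<^sup>2)"
proof -
  have "complex_of_real (\<integral>x. (cmod (Zsum A c x))\<^sup>2 \<partial>P) = L2_inner P (Zsum A c) (Zsum A c)"
    by (simp add: L2_inner_def complex_norm_square mult.commute flip: integral_complex_of_real del: of_real_power)
  also have "\<dots> = (\<Sum>\<sigma>\<in>A. c \<sigma> * cnj (coef \<sigma> (Zsum A c)))"
    by (simp add: L2_inner_Zsum[OF assms Zsum_L2[OF assms(2)]] L2_inner_commute[of "Zsum A c" "Zprod M _"])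
  also have "\<dots> = complex_of_real (\<Sum>\<sigma>\<in>A. (cmod (c \<sigma>))\<^sup>2)"
    unfolding of_real_sum
    using coef_Zsum[OF assms] assms(2) by (intro sum.cong) (auto simp: complex_norm_square simp del: of_real_power dest: subsetD)
  finally show ?thesis
    unfolding of_real_eq_iff .
qed

section \<open>Weighted coefficients and the spaces \<open>Sp\<close> and
  \<open>S_space\<close>\<close>

definition wcoef :: "nat \<Rightarrow> ('a \<Rightarrow> complex) \<Rightarrow> nat set \<Rightarrow> real" where
  "wcoef p \<xi> \<sigma> = lam \<sigma> ^ p * cmod (coef \<sigma> \<xi>)"

lemma wcoef_square: "(wcoef p \<xi> \<sigma>)\<^sup>2 = lam \<sigma> ^ (2 * p) * (cmod (coef \<sigma> \<xi>))\<^sup>2"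
  by (simp add: wcoef_def power_mult_distrib power_even_eq)

lemma wcoef_nonneg: "0 \<le> wcoef p \<xi> \<sigma>"
  using lam_ge_1[of \<sigma>] by (simp add: wcoef_def)

lemma Sp_eq: "Sp P M p = {\<xi> \<in> L2 P M. (\<lambda>\<sigma>. (wcoef p \<xi> \<sigma>)\<^sup>2) summable_on Gam}"
  by (simp add: Sp_def wcoef_square)

lemma Sp_norm_eq: "Sp_norm P M p \<xi> = sqrt (\<Sum>\<^sub>\<infinity>\<sigma>\<in>Gam. (wcoef p \<xi> \<sigma>)\<^sup>2)"
  by (simp add: Sp_norm_def wcoef_square)

lemma Sp_norm_nonneg: "0 \<le> Sp_norm P M p \<xi>"
  by (simp add: Sp_norm_eq infsum_nonneg)

lemma Sp_L2: "\<xi> \<in> Sp P M p \<Longrightarrow> \<xi> \<in> L2 P M"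
  by (simp add: Sp_def)

lemma L2_set_wcoef_le:
  "\<xi> \<in> Sp P M p \<Longrightarrow> finite A \<Longrightarrow> A \<subseteq> Gam \<Longrightarrow> L2_set (wcoef p \<xi>) A \<le> Sp_norm P M p \<xi>"
  unfolding Sp_norm_eq by (rule L2_set_le_sqrt_infsum) (simp_all add: Sp_eq)

text \<open>With the weight moved inside the square by \<open>wcoef\<close>, \<open>Sp_norm\<close>
  is an l2 norm of coefficients. Testing it on finite index sets makes the Minkowski inequality for
  \<open>L2_set\<close> available, as used in \<open>Sp_lincomb\<close>.\<close>

lemma SpI:
  assumes "\<xi> \<in> L2 P M" "\<And>A. finite A \<Longrightarrow> A \<subseteq> Gam \<Longrightarrow> L2_set (wcoef p \<xi>) A \<le> K"
  shows "\<xi> \<in> Sp P M p" and Sp_norm_leI: "Sp_norm P M p \<xi> \<le> K"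
  using L2_set_bounded_imp_summable[of Gam "wcoef p \<xi>" K, OF assms(2)] assms(1)
  by (auto simp: Sp_eq Sp_norm_eq)

lemma Sp_lincomb:
  assumes "\<xi> \<in> Sp P M p" "\<eta> \<in> Sp P M p"
  shows "(\<lambda>x. a * \<xi> x + b * \<eta> x) \<in> Sp P M p"
    and "Sp_norm P M p (\<lambda>x. a * \<xi> x + b * \<eta> x) \<le> cmod a * Sp_norm P M p \<xi> + cmod b * Sp_norm P M p \<eta>"
proof -
  have L2: "\<xi> \<in> L2 P M" "\<eta> \<in> L2 P M"
    using assms by (auto dest: Sp_L2)
  then have L2': "(\<lambda>x. a * \<xi> x + b * \<eta> x) \<in> L2 P M"
    by (rule function_space_lincomb[OF function_space_L2])
  have le: "L2_set (wcoef p (\<lambda>x. a * \<xi> x + b * \<eta> x)) A \<le> cmod a * Sp_norm P M p \<xi> + cmod b * Sp_norm P M p \<eta>"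
    if A: "finite A" "A \<subseteq> Gam" for A
  proof -
    have "wcoef p (\<lambda>x. a * \<xi> x + b * \<eta> x) \<sigma> \<le> cmod a * wcoef p \<xi> \<sigma> + cmod b * wcoef p \<eta> \<sigma>"
      if "\<sigma> \<in> A" for \<sigma>
    proof -
      have "finite \<sigma>"
        using that A by blast
      then have "wcoef p (\<lambda>x. a * \<xi> x + b * \<eta> x) \<sigma> = lam \<sigma> ^ p * cmod (a * coef \<sigma> \<xi> + b * coef \<sigma> \<eta>)"
        by (simp add: wcoef_def L2_inner_lincomb Zprod_L2 L2)
      also have "\<dots> \<le> lam \<sigma> ^ p * (cmod a * cmod (coef \<sigma> \<xi>) + cmod b * cmod (coef \<sigma> \<eta>))"
        using lam_ge_1[of \<sigma>] norm_triangle_ineq[of "a * coef \<sigma> \<xi>" "b * coef \<sigma> \<eta>"]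
        by (intro mult_left_mono) (auto simp: norm_mult)
      finally show ?thesis
        by (simp add: wcoef_def algebra_simps)
    qed
    then have "L2_set (wcoef p (\<lambda>x. a * \<xi> x + b * \<eta> x)) A
        \<le> L2_set (\<lambda>\<sigma>. cmod a * wcoef p \<xi> \<sigma> + cmod b * wcoef p \<eta> \<sigma>) A"
      by (intro L2_set_mono wcoef_nonneg)
    also have "\<dots> \<le> L2_set (\<lambda>\<sigma>. cmod a * wcoef p \<xi> \<sigma>) A + L2_set (\<lambda>\<sigma>. cmod b * wcoef p \<eta> \<sigma>) A"
      by (rule L2_set_triangle_ineq)
    also have "\<dots> = cmod a * L2_set (wcoef p \<xi>) A + cmod b * L2_set (wcoef p \<eta>) A"
      by (simp add: L2_set_right_distrib)
    also have "\<dots> \<le> cmod a * Sp_norm P M p \<xi> + cmod b * Sp_norm P M p \<eta>"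
      using assms A by (intro add_mono mult_left_mono L2_set_wcoef_le) auto
    finally show ?thesis .
  qed
  show "(\<lambda>x. a * \<xi> x + b * \<eta> x) \<in> Sp P M p"
    by (rule SpI[OF L2' le])
  show "Sp_norm P M p (\<lambda>x. a * \<xi> x + b * \<eta> x) \<le> cmod a * Sp_norm P M p \<xi> + cmod b * Sp_norm P M p \<eta>"
    by (rule Sp_norm_leI[OF L2' le])
qed

lemma function_space_Sp: "function_space (Sp P M p)"
proof -
  have "(\<lambda>_. 0) \<in> Sp P M p"
    using function_space_zero[OF function_space_L2] by (simp add: Sp_def L2_inner_zero)
  then show ?thesis
    by (auto simp: function_space_def intro: Sp_lincomb)
qed

lemma function_space_S: "function_space (S_space P M)"
  using function_space_Sp by (auto simp: function_space_def S_space_def)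

lemma Sp_norm_cmult: "Sp_norm P M p (\<lambda>x. c * \<xi> x) = cmod c * Sp_norm P M p \<xi>"
proof -
  have "coef \<sigma> (\<lambda>x. c * \<xi> x) = c * coef \<sigma> \<xi>" for \<sigma>
    by (simp add: L2_inner_def mult.left_commute)
  then have "(wcoef p (\<lambda>x. c * \<xi> x) \<sigma>)\<^sup>2 = (cmod c)\<^sup>2 * (wcoef p \<xi> \<sigma>)\<^sup>2" for \<sigma>
    by (simp add: wcoef_square norm_mult power_mult_distrib)
  then show ?thesis
    by (simp add: Sp_norm_eq infsum_cmult_right' real_sqrt_mult)
qed

lemma seminorm_on_Sp_norm: "seminorm_on (Sp P M p) (Sp_norm P M p)"
  unfolding seminorm_on_def
  using Sp_norm_nonneg Sp_lincomb(2)[of _ p _ 1 1] Sp_norm_cmult by simp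

sublocale Sp: seminormed_space "Sp P M p" "{Sp_norm P M p}" for p
  by unfold_locales (auto simp: function_space_Sp seminorm_on_Sp_norm)

lemma S_Sp: "\<xi> \<in> S_space P M \<Longrightarrow> \<xi> \<in> Sp P M p"
  by (simp add: S_space_def)

sublocale S: seminormed_space "S_space P M" "range (Sp_norm P M)"
proof
  show "function_space (S_space P M)"
    by (rule function_space_S)
  show "seminorm_on (S_space P M) q" if q: "q \<in> range (Sp_norm P M)" for q
    using q seminorm_on_Sp_norm S_Sp by (fastforce simp: seminorm_on_def)
qed auto

sublocale weak: seminormed_space "S_dual P M" "{\<lambda>F. cmod (F f) | f. f \<in> S_space P M}"
  using S.weak_dual_seminormed_space by (simp add: S_dual_def S_topology_def)

sublocale strong: seminormed_space "S_dual P M"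
    "{\<lambda>F. SUP f\<in>B. cmod (F f) | B. tvs_bounded (S_topology P M) B \<and> B \<noteq> {}}"
  using S.strong_dual_seminormed_space by (simp add: S_dual_def S_topology_def)

lemma wcoef_Zsum:
  assumes "finite A" "A \<subseteq> Gam" "finite \<sigma>"
  shows "wcoef p (Zsum A c) \<sigma> = (if \<sigma> \<in> A then lam \<sigma> ^ p * cmod (c \<sigma>) else 0)"
  by (simp add: wcoef_def coef_Zsum assms)

lemma
  assumes "finite A" "A \<subseteq> Gam"
  shows Zsum_S: "Zsum A c \<in> S_space P M"
    and Sp_norm_Zsum: "Sp_norm P M p (Zsum A c) = L2_set (\<lambda>\<sigma>. lam \<sigma> ^ p * cmod (c \<sigma>)) A"
proof -
  have zero: "(wcoef p (Zsum A c) \<sigma>)\<^sup>2 = 0" if "\<sigma> \<in> Gam - A" for p \<sigma>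
    using that assms by (simp add: wcoef_Zsum)
  have "(\<lambda>\<sigma>. (wcoef p (Zsum A c) \<sigma>)\<^sup>2) summable_on Gam" for p
    by (rule iffD1[OF summable_on_cong_neutral, OF _ _ _ summable_on_finite[OF assms(1)]])
      (use assms zero in auto)
  then show "Zsum A c \<in> S_space P M"
    using Zsum_L2[OF assms(2)] by (simp add: S_space_def Sp_eq)
  have "(\<Sum>\<^sub>\<infinity>\<sigma>\<in>Gam. (wcoef p (Zsum A c) \<sigma>)\<^sup>2) = (\<Sum>\<^sub>\<infinity>\<sigma>\<in>A. (wcoef p (Zsum A c) \<sigma>)\<^sup>2)"
    by (rule infsum_cong_neutral) (use assms zero in auto)
  also have "\<dots> = (\<Sum>\<sigma>\<in>A. (lam \<sigma> ^ p * cmod (c \<sigma>))\<^sup>2)"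
    using assms wcoef_Zsum[OF assms] by (subst infsum_finite[OF assms(1)], intro sum.cong) (auto dest: subsetD)
  finally show "Sp_norm P M p (Zsum A c) = L2_set (\<lambda>\<sigma>. lam \<sigma> ^ p * cmod (c \<sigma>)) A"
    by (simp add: Sp_norm_eq L2_set_def)
qed

lemma Zprod_S: "finite \<sigma> \<Longrightarrow> Zprod M \<sigma> \<in> S_space P M"
  using Zsum_S[of "{\<sigma>}" "\<lambda>_. 1"] by (simp add: Zsum_def[abs_def])

text \<open>Subtracting the partial expansion deletes exactly the coefficients indexed by subsets of
  \<open>{0..n}\<close>. As the norm is computed from the coefficients, its square is the remainder
  of a convergent sum.\<close>

lemma Sp_norm_tail_tendsto:
  assumes "\<xi> \<in> Sp P M p"
  shows "(\<lambda>n. Sp_norm P M p (\<lambda>x. \<xi> x - Zsum (Pow {0..n}) (\<lambda>\<sigma>. coef \<sigma> \<xi>) x)) \<longlonglongrightarrow> 0"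
proof -
  let ?f = "\<lambda>\<sigma>. (wcoef p \<xi> \<sigma>)\<^sup>2"
  have summable: "?f summable_on Gam"
    using assms by (simp add: Sp_eq)
  have Pow: "Pow {0..n} \<subseteq> Gam" for n :: nat
    by (auto intro: finite_subset)
  have "Sp_norm P M p (\<lambda>x. \<xi> x - Zsum (Pow {0..n}) (\<lambda>\<sigma>. coef \<sigma> \<xi>) x) = sqrt (infsum ?f Gam - sum ?f (Pow {0..n}))" for n
  proof -
    let ?\<eta> = "\<lambda>x. \<xi> x - Zsum (Pow {0..n}) (\<lambda>\<sigma>. coef \<sigma> \<xi>) x"
    have "coef \<sigma> ?\<eta> = (if \<sigma> \<in> Pow {0..n} then 0 else coef \<sigma> \<xi>)" if "\<sigma> \<in> Gam" for \<sigma>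
      using L2_inner_lincomb[of "Zprod M \<sigma>" \<xi> "Zsum (Pow {0..n}) (\<lambda>\<sigma>. coef \<sigma> \<xi>)" 1 "-1"]
        coef_Zsum[of "Pow {0..n}" \<sigma>] Zsum_L2[OF Pow] Zprod_L2[of \<sigma>] Sp_L2[OF assms] that Pow
      by simp
    then have w: "(wcoef p ?\<eta> \<sigma>)\<^sup>2 = (if \<sigma> \<in> Pow {0..n} then 0 else ?f \<sigma>)" if "\<sigma> \<in> Gam" for \<sigma>
      using that by (simp add: wcoef_def)
    have "(\<Sum>\<^sub>\<infinity>\<sigma>\<in>Gam. (wcoef p ?\<eta> \<sigma>)\<^sup>2) = infsum ?f (Gam - Pow {0..n})"
      by (rule infsum_cong_neutral) (use w in \<open>auto split: if_splits\<close>)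
    also have "\<dots> = infsum ?f Gam - infsum ?f (Pow {0..n})"
      by (rule infsum_Diff) (use summable Pow in auto)
    finally show ?thesis
      by (simp add: Sp_norm_eq)
  qed
  moreover have "(\<lambda>n. sum ?f (Pow {0..n})) \<longlonglongrightarrow> infsum ?f Gam"
    using infsum_tendsto[OF summable] filterlim_Pow_finite_subsets_at_top by (rule filterlim_compose)
  then have "(\<lambda>n. sqrt (infsum ?f Gam - sum ?f (Pow {0..n}))) \<longlonglongrightarrow> sqrt (infsum ?f Gam - infsum ?f Gam)"
    by (intro tendsto_intros)
  ultimately show ?thesis
    by simp
qed

section \<open>Generalized functionals\<close>

lemma finite_Pow_Gam: "finite (Pow {0..n::nat})" "Pow {0..n::nat} \<subseteq> Gam"
  by (auto intro: finite_subset)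

definition energy :: "(nat set \<Rightarrow> complex) \<Rightarrow> nat \<Rightarrow> nat set set \<Rightarrow> real" where
  "energy a p A = (\<Sum>\<sigma>\<in>A. (cmod (a \<sigma>) / lam \<sigma> ^ p)\<^sup>2)"

lemma energy_nonneg: "0 \<le> energy a p A"
  by (simp add: energy_def sum_nonneg)

text \<open>Cauchy-Schwarz after splitting \<open>lam \<sigma> ^ p\<close> between the two factors:
  dividing the coefficient of the functional and multiplying that of \<open>\<xi>\<close>.\<close>

lemma pairing_bound:
  assumes "finite A" "A \<subseteq> Gam" "\<xi> \<in> Sp P M p"
  shows "cmod (\<Sum>\<sigma>\<in>A. a \<sigma> * coef \<sigma> \<xi>) \<le> sqrt (energy a p A) * Sp_norm P M p \<xi>"
proof -
  have lam: "lam \<sigma> > 0" "lam \<sigma> \<noteq> 0" for \<sigma>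
    using lam_ge_1[of \<sigma>] by auto
  have "cmod (\<Sum>\<sigma>\<in>A. a \<sigma> * coef \<sigma> \<xi>) \<le> (\<Sum>\<sigma>\<in>A. cmod (a \<sigma> * coef \<sigma> \<xi>))"
    by (rule norm_sum)
  also have "\<dots> = (\<Sum>\<sigma>\<in>A. \<bar>cmod (a \<sigma>) / lam \<sigma> ^ p\<bar> * \<bar>wcoef p \<xi> \<sigma>\<bar>)"
    by (intro sum.cong refl) (simp add: norm_mult wcoef_def abs_mult lam less_imp_le)
  also have "\<dots> \<le> L2_set (\<lambda>\<sigma>. cmod (a \<sigma>) / lam \<sigma> ^ p) A * L2_set (wcoef p \<xi>) A"
    by (rule L2_set_mult_ineq)
  also have "\<dots> \<le> L2_set (\<lambda>\<sigma>. cmod (a \<sigma>) / lam \<sigma> ^ p) A * Sp_norm P M p \<xi>"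
    by (intro mult_left_mono L2_set_wcoef_le assms L2_set_nonneg)
  finally show ?thesis
    by (simp add: L2_set_def energy_def)
qed

section \<open>Expansion and norm bounds of continuous functionals\<close>

lemma S_dual_linear:
  assumes "F \<in> S_dual P M" "\<xi> \<in> S_space P M" "\<eta> \<in> S_space P M"
  shows "F (\<lambda>x. a * \<xi> x + b * \<eta> x) = a * F \<xi> + b * F \<eta>"
  using assms by (simp add: S_dual_def topological_dual_def)

lemma S_dual_Zsum:
  assumes F: "F \<in> S_dual P M" and A: "finite A" "A \<subseteq> Gam"
  shows "F (Zsum A c) = (\<Sum>\<sigma>\<in>A. c \<sigma> * F (Zprod M \<sigma>))"
  using A
proof (induction A)
  case empty
  have "F (\<lambda>x. 0 * 0 + 0 * 0) = 0 * F (\<lambda>_. 0) + 0 * F (\<lambda>_. 0)"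
    by (rule S_dual_linear[OF F]) (rule function_space_zero[OF function_space_S])+
  then show ?case
    by (simp add: Zsum_def[abs_def])
next
  case (insert \<sigma> A)
  then show ?case
    using S_dual_linear[OF F Zprod_S Zsum_S, of \<sigma> A "c \<sigma>" 1 c] by (simp add: Zsum_insert)
qed

text \<open>Continuity dominates \<open>F\<close> by finitely many norms, so \<open>F\<close> tends
  to 0 along the remainders of the expansion of \<open>\<xi>\<close>. From \<open>m = n\<close> on,
  further terms contribute nothing, so this sequence is eventually constant and the constant must be
  0.\<close>

lemma S_dual_expansion:
  assumes F: "F \<in> S_dual P M" and \<xi>: "\<xi> \<in> S_space P M"
    and supp: "\<And>\<sigma>. finite \<sigma> \<Longrightarrow> \<not> \<sigma> \<subseteq> {0..n} \<Longrightarrow> F (Zprod M \<sigma>) = 0"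
  shows "F \<xi> = (\<Sum>\<sigma>\<in>Pow {0..n}. F (Zprod M \<sigma>) * coef \<sigma> \<xi>)"
proof -
  let ?P = "\<lambda>m. Zsum (Pow {0..m}) (\<lambda>\<sigma>. coef \<sigma> \<xi>)"
  have F': "F \<in> topological_dual (S_space P M) (seminorm_topology (S_space P M) (range (Sp_norm P M)))"
    using F by (simp add: S_dual_def S_topology_def)
  obtain Q C where Q: "finite Q" "Q \<subseteq> range (Sp_norm P M)" "C \<ge> 0"
    "\<And>f. f \<in> S_space P M \<Longrightarrow> cmod (F f) \<le> C * (\<Sum>q\<in>Q. q f)"
    by (rule S.topological_dual_bound[OF F']) (rule that)
  have PS: "?P m \<in> S_space P M" for m
    by (rule Zsum_S[OF finite_Pow_Gam])
  have "(\<lambda>m. q (\<lambda>x. \<xi> x - ?P m x)) \<longlonglongrightarrow> 0" if q: "q \<in> Q" for q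
  proof -
    obtain p where "q = Sp_norm P M p"
      using Q(2) q by blast
    then show ?thesis
      using Sp_norm_tail_tendsto[OF S_Sp[OF \<xi>], of p] by simp
  qed
  then have "(\<lambda>m. C * (\<Sum>q\<in>Q. q (\<lambda>x. \<xi> x - ?P m x))) \<longlonglongrightarrow> C * (\<Sum>q\<in>Q. 0)"
    by (intro tendsto_mult tendsto_const tendsto_sum)
  then have "(\<lambda>m. F (\<lambda>x. \<xi> x - ?P m x)) \<longlonglongrightarrow> 0"
    using Q(4)[OF function_space_diff[OF function_space_S \<xi> PS]]
    by (intro Lim_null_comparison[of "\<lambda>m. F (\<lambda>x. \<xi> x - ?P m x)" "\<lambda>m. C * (\<Sum>q\<in>Q. q (\<lambda>x. \<xi> x - ?P m x))"]
        always_eventually) simp_all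
  moreover have "F (\<lambda>x. \<xi> x - ?P m x) = F \<xi> - (\<Sum>\<sigma>\<in>Pow {0..n}. F (Zprod M \<sigma>) * coef \<sigma> \<xi>)" if "m \<ge> n" for m
  proof -
    have "F (\<lambda>x. \<xi> x - ?P m x) = F \<xi> - F (?P m)"
      using S_dual_linear[OF F \<xi> PS, of 1 "-1"] by simp
    also have "F (?P m) = (\<Sum>\<sigma>\<in>Pow {0..m}. coef \<sigma> \<xi> * F (Zprod M \<sigma>))"
      by (rule S_dual_Zsum[OF F finite_Pow_Gam])
    also have "\<dots> = (\<Sum>\<sigma>\<in>Pow {0..n}. coef \<sigma> \<xi> * F (Zprod M \<sigma>))"
    proof (rule sum.mono_neutral_right)
      show "\<forall>\<sigma>\<in>Pow {0..m} - Pow {0..n}. coef \<sigma> \<xi> * F (Zprod M \<sigma>) = 0"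
      proof
        fix \<sigma> assume "\<sigma> \<in> Pow {0..m} - Pow {0..n}"
        then have "finite \<sigma>" "\<not> \<sigma> \<subseteq> {0..n}"
          using finite_Pow_Gam(2)[of m] by blast+
        then show "coef \<sigma> \<xi> * F (Zprod M \<sigma>) = 0"
          by (simp add: supp)
      qed
    qed (use that in auto)
    finally show ?thesis
      by (simp add: mult.commute)
  qed
  then have "\<forall>\<^sub>F m in sequentially. F (\<lambda>x. \<xi> x - ?P m x) = F \<xi> - (\<Sum>\<sigma>\<in>Pow {0..n}. F (Zprod M \<sigma>) * coef \<sigma> \<xi>)"
    by (rule eventually_sequentiallyI)
  ultimately have "(\<lambda>m. F \<xi> - (\<Sum>\<sigma>\<in>Pow {0..n}. F (Zprod M \<sigma>) * coef \<sigma> \<xi>)) \<longlonglongrightarrow> 0"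
    by (rule Lim_transform_eventually)
  then show ?thesis
    by (simp add: LIMSEQ_const_iff)
qed

text \<open>Normalise \<open>\<xi>\<close> and compare with the supremum over the unit ball.
  Continuity first has to bound the values there, to make the supremum meaningful.\<close>

lemma Sp_dual_bound:
  assumes F: "F \<in> Sp_dual P M p" and \<xi>: "\<xi> \<in> Sp P M p"
  shows "cmod (F \<xi>) \<le> Sp_dual_norm P M p F * Sp_norm P M p \<xi>"
proof -
  let ?U = "{\<xi> \<in> Sp P M p. Sp_norm P M p \<xi> \<le> 1}"
  have F': "F \<in> topological_dual (Sp P M p) (seminorm_topology (Sp P M p) {Sp_norm P M p})"
    using F by (simp add: Sp_dual_def)
  obtain Q C where Q: "finite Q" "Q \<subseteq> {Sp_norm P M p}" "C \<ge> 0"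
    "\<And>f. f \<in> Sp P M p \<Longrightarrow> cmod (F f) \<le> C * (\<Sum>q\<in>Q. q f)"
    by (rule Sp.topological_dual_bound[OF F']) (rule that)
  have bound: "cmod (F f) \<le> C * Sp_norm P M p f" if "f \<in> Sp P M p" for f
  proof -
    \<comment> \<open>\<open>Q\<close> is either empty or the singleton of the norm; enlarging it to
      the singleton covers both cases.\<close>
    have "(\<Sum>q\<in>Q. q f) \<le> (\<Sum>q\<in>{Sp_norm P M p}. q f)"
      using Q(2) Sp_norm_nonneg by (intro sum_mono2) auto
    then show ?thesis
      using Q(4)[OF that] mult_left_mono[OF _ Q(3)] by fastforce
  qed
  have bdd: "bdd_above ((\<lambda>\<xi>. cmod (F \<xi>)) ` ?U)"
  proof (rule bdd_aboveI2)
    fix f assume f: "f \<in> ?U"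
    then have "cmod (F f) \<le> C * Sp_norm P M p f"
      by (intro bound) simp
    also have "\<dots> \<le> C * 1"
      using f Q(3) by (intro mult_left_mono) auto
    finally show "cmod (F f) \<le> C * 1" .
  qed
  show ?thesis
  \<comment> \<open>A vector of norm 0 cannot be normalised; there the continuity bound gives
    \<open>F \<xi> = 0\<close>.\<close>
  proof (cases "Sp_norm P M p \<xi> = 0")
    case True
    then show ?thesis
      using bound[OF \<xi>] by simp
  next
    case False
    define t where "t = Sp_norm P M p \<xi>"
    have t: "t > 0"
      using False Sp_norm_nonneg[of p \<xi>] by (simp add: t_def)
    let ?\<eta> = "\<lambda>x. complex_of_real (1 / t) * \<xi> x"
    have "Sp_norm P M p ?\<eta> = 1"
      using Sp_norm_cmult[of p "complex_of_real (1 / t)" \<xi>] t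
      by (simp add: norm_divide t_def[symmetric])
    moreover have "?\<eta> \<in> Sp P M p"
      by (rule function_space_cmult[OF function_space_Sp \<xi>])
    ultimately have "?\<eta> \<in> ?U"
      by simp
    then have "cmod (F ?\<eta>) \<le> Sp_dual_norm P M p F"
      unfolding Sp_dual_norm_def by (rule cSUP_upper[OF _ bdd])
    moreover have "F ?\<eta> = complex_of_real (1 / t) * F \<xi>"
    proof -
      have lin: "\<forall>f\<in>Sp P M p. \<forall>g\<in>Sp P M p. \<forall>a b. F (\<lambda>x. a * f x + b * g x) = a * F f + b * F g"
        using F by (simp add: Sp_dual_def topological_dual_def)
      then have "F (\<lambda>x. complex_of_real (1 / t) * \<xi> x + 0 * \<xi> x) = complex_of_real (1 / t) * F \<xi> + 0 * F \<xi>"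
        using \<xi> by blast
      then show ?thesis
        by simp
    qed
    ultimately have "cmod (complex_of_real (1 / t) * F \<xi>) \<le> Sp_dual_norm P M p F"
      by (simp only:)
    then show ?thesis
      using t by (simp add: norm_mult norm_divide t_def[symmetric] field_simps)
  qed
qed

section \<open>A gliding hump\<close>

text \<open>This substitutes for the completeness of \<open>L\<^sup>2\<close>.\<close>

lemma L2_series:
  assumes X: "\<And>k. X k \<in> L2 P M" and sum: "summable (\<lambda>k. 4 ^ k * (\<integral>x. (cmod (X k x))\<^sup>2 \<partial>P))"
  obtains \<xi> where "\<xi> \<in> L2 P M" "\<And>\<eta>. \<eta> \<in> L2 P M \<Longrightarrow> (\<lambda>k. L2_inner P \<eta> (X k)) sums L2_inner P \<eta> \<xi>"
proof -
  \<comment> \<open>The weights \<open>4 ^ k\<close> let one integrable function, a multiple of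
    \<open>H\<close>, bound the squares of all partial sums at once.\<close>
  define g where "g k x = 4 ^ k * (cmod (X k x))\<^sup>2" for k x
  define H where "H x = (\<Sum>k. g k x)" for x
  \<comment> \<open>Defined pointwise, with the default value of \<open>suminf\<close> where the
    series diverges, so that \<open>\<xi>\<close> is measurable for the generated algebra itself and
    not just up to a null set.\<close>
  define \<xi> where "\<xi> x = (\<Sum>k. X k x)" for x
  have [measurable]: "X k \<in> borel_measurable P" for k
    by (rule L2_borel_measurable[OF X])
  have \<xi>_meas: "\<xi> \<in> borel_measurable (generated_algebra P M UNIV)"
    unfolding \<xi>_def[abs_def] using X by (intro borel_measurable_suminf) (simp add: L2_def)
  have [measurable]: "\<xi> \<in> borel_measurable P"
    by (rule measurable_from_subalg[OF subalgebra_generated_algebra \<xi>_meas])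
  have g_int: "integrable P (g k)" for k
    unfolding g_def[abs_def] using L2_square_integrable[OF X] by simp
  have g_nonneg: "0 \<le> g k x" for k x
    by (simp add: g_def)
  have g_sum: "summable (\<lambda>k. \<integral>x. g k x \<partial>P)"
    using sum by (simp add: g_def)
  have [measurable]: "g k \<in> borel_measurable P" for k
    unfolding g_def[abs_def] by measurable
  have "(\<integral>\<^sup>+x. (\<Sum>k. ennreal (g k x)) \<partial>P) = (\<Sum>k. \<integral>\<^sup>+x. ennreal (g k x) \<partial>P)"
    by (rule nn_integral_suminf) measurable
  also have "\<dots> = (\<Sum>k. ennreal (\<integral>x. g k x \<partial>P))"
    using g_int g_nonneg by (simp add: nn_integral_eq_integral)
  also have "\<dots> \<noteq> \<infinity>"
    using g_sum g_nonneg by (simp add: ennreal_suminf_neq_top)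
  \<comment> \<open>Integrating the nonnegative series term by term gives a finite value, hence the
    series is finite almost everywhere.\<close>
  finally have "AE x in P. (\<Sum>k. ennreal (g k x)) \<noteq> \<infinity>"
    by (intro nn_integral_PInf_AE) auto
  then have g_summable: "AE x in P. summable (\<lambda>k. g k x)"
    by eventually_elim (auto intro: summable_suminf_not_top g_nonneg)
  have H_int: "integrable P H"
    unfolding H_def[abs_def] using g_summable g_sum g_nonneg
    by (intro integrable_suminf g_int) auto
  have partial: "AE x in P. \<forall>n. (cmod (\<Sum>k<n. X k x))\<^sup>2 \<le> 2 * H x"
    using g_summable
  proof eventually_elim
    case (elim x)
    have "(cmod (\<Sum>k<n. X k x))\<^sup>2 \<le> 2 * H x" for n
    proof -
      have "(cmod (\<Sum>k<n. X k x))\<^sup>2 \<le> (\<Sum>k<n. cmod (X k x))\<^sup>2"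
        by (intro power_mono norm_sum) auto
      also have "\<dots> \<le> 2 * (\<Sum>k<n. g k x)"
        unfolding g_def by (rule sum_square_le_weighted)
      also have "\<dots> \<le> 2 * H x"
        unfolding H_def using elim g_nonneg by (intro mult_left_mono sum_le_suminf) auto
      finally show ?thesis .
    qed
    then show ?case by blast
  qed
  have conv: "AE x in P. (\<lambda>n. \<Sum>k<n. X k x) \<longlonglongrightarrow> \<xi> x"
    using g_summable
  proof eventually_elim
    case (elim x)
    have "summable (\<lambda>k. (1 / 4) ^ k + g k x)"
      using elim by (intro summable_add summable_geometric) auto
    then have "summable (\<lambda>k. X k x)"
      by (rule summable_comparison_test'[where N = 0]) (simp add: g_def le_quarter_power_plus)
    then show ?case
      unfolding \<xi>_def by (rule summable_LIMSEQ)
  qed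
  have \<xi>_bound: "AE x in P. (cmod (\<xi> x))\<^sup>2 \<le> 2 * H x"
    using partial conv
  proof eventually_elim
    case (elim x)
    have "(\<lambda>n. (cmod (\<Sum>k<n. X k x))\<^sup>2) \<longlonglongrightarrow> (cmod (\<xi> x))\<^sup>2"
      by (intro tendsto_intros elim)
    then show ?case
      by (rule LIMSEQ_le_const2) (use elim in blast)
  qed
  have "integrable P (\<lambda>x. (cmod (\<xi> x))\<^sup>2)"
  proof (rule Bochner_Integration.integrable_bound)
    show "integrable P (\<lambda>x. 2 * H x)"
      using H_int by simp
    show "AE x in P. norm ((cmod (\<xi> x))\<^sup>2) \<le> norm (2 * H x)"
      using \<xi>_bound by eventually_elim auto
  qed measurable
  then have \<xi>: "\<xi> \<in> L2 P M"
    using \<xi>_meas by (simp add: L2_def)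
  have "(\<lambda>k. L2_inner P \<eta> (X k)) sums L2_inner P \<eta> \<xi>" if \<eta>: "\<eta> \<in> L2 P M" for \<eta>
  proof -
    have [measurable]: "\<eta> \<in> borel_measurable P"
      by (rule L2_borel_measurable[OF \<eta>])
    have "(\<lambda>n. \<integral>x. cnj (\<eta> x) * (\<Sum>k<n. X k x) \<partial>P) \<longlonglongrightarrow> (\<integral>x. cnj (\<eta> x) * \<xi> x \<partial>P)"
    proof (rule integral_dominated_convergence)
      \<comment> \<open>The dominating function comes from bounding a product by the sum of the two
        squares, the second square being at most \<open>2 * H x\<close>.\<close>
      show "integrable P (\<lambda>x. (cmod (\<eta> x))\<^sup>2 + 2 * H x)"
        using H_int L2_square_integrable[OF \<eta>] by simp
      show "AE x in P. (\<lambda>n. cnj (\<eta> x) * (\<Sum>k<n. X k x)) \<longlonglongrightarrow> cnj (\<eta> x) * \<xi> x"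
        using conv by eventually_elim (intro tendsto_intros)
      show "AE x in P. cmod (cnj (\<eta> x) * (\<Sum>k<n. X k x)) \<le> (cmod (\<eta> x))\<^sup>2 + 2 * H x" for n
        using partial
      proof eventually_elim
        case (elim x)
        let ?s = "cmod (\<Sum>k<n. X k x)"
        have "cmod (\<eta> x) * ?s \<le> (cmod (\<eta> x))\<^sup>2 + ?s\<^sup>2"
          using zero_le_power2[of "cmod (\<eta> x) - ?s"] zero_le_power2[of "cmod (\<eta> x)"] zero_le_power2[of ?s]
          unfolding power2_diff by linarith
        also have "?s\<^sup>2 \<le> 2 * H x"
          using elim by blast
        finally show ?case
          by (simp add: norm_mult)
      qed
    qed measurable
    moreover have "(\<integral>x. cnj (\<eta> x) * (\<Sum>k<n. X k x) \<partial>P) = (\<Sum>k<n. L2_inner P \<eta> (X k))" for n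
      unfolding L2_inner_def sum_distrib_left
      by (rule Bochner_Integration.integral_sum) (rule L2_mult_integrable[OF \<eta> X])
    ultimately show ?thesis
      by (simp add: sums_def L2_inner_def)
  qed
  with \<xi> that show thesis
    by blast
qed

lemma gliding_hump:
  assumes unbounded: "\<And>p K. \<exists>n. energy a p (Pow {0..n}) > K"
  obtains \<xi> where "\<xi> \<in> S_space P M"
    "\<And>K. \<exists>n. cmod (\<Sum>\<sigma>\<in>Pow {0..n}. a \<sigma> * coef \<sigma> \<xi>) \<ge> real K"
proof -
  have mono: "energy a p (Pow {0..m}) \<le> energy a p (Pow {0..n})" if "m \<le> n" for p m n
    unfolding energy_def using that by (intro sum_mono2) auto
  \<comment> \<open>Step \<open>k\<close> uses the energy of order \<open>k\<close>, so that every
    fixed order is eventually exceeded. \<open>True\<close> fills the place of the invariant in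
    \<open>dependent_nat_choice\<close>.\<close>
  have "\<exists>N. \<forall>k. True \<and> (N k < N (Suc k) \<and>
      energy a k (Pow {0..N (Suc k)}) > energy a k (Pow {0..N k}) + 8 ^ k)"
  proof (rule dependent_nat_choice)
    fix n k
    obtain m where m: "energy a k (Pow {0..m}) > energy a k (Pow {0..n}) + 8 ^ k"
      using unbounded by blast
    \<comment> \<open>Energy grows with the cutoff, so a positive increment forces the new cutoff
      beyond the old one.\<close>
    have "(0::real) < 8 ^ k"
      by simp
    with m mono[of m n k] have "n < m"
      by linarith
    with m show "\<exists>m. True \<and> n < m \<and> energy a k (Pow {0..m}) > energy a k (Pow {0..n}) + 8 ^ k"
      by blast
  qed auto
  then obtain N where N: "\<And>k. N k < N (Suc k)"
    and big: "\<And>k. energy a k (Pow {0..N (Suc k)}) > energy a k (Pow {0..N k}) + 8 ^ k"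
    by blast
  have N_mono: "strict_mono N"
    using N by (simp add: strict_mono_Suc_iff)
  define B where "B k = Pow {0..N (Suc k)} - Pow {0..N k}" for k
  define e where "e k = energy a k (B k)" for k
  \<comment> \<open>The division by \<open>e k\<close> normalises the pairing of \<open>a\<close>
    with the \<open>k\<close>-th block to 1.\<close>
  define c where "c k \<sigma> = cnj (a \<sigma>) / complex_of_real (lam \<sigma> ^ (2 * k) * e k)" for k \<sigma>
  define X where "X k = Zsum (B k) (c k)" for k
  have B: "finite (B k)" "B k \<subseteq> Gam" for k
    by (auto simp: B_def intro: finite_subset)
  have lam_pos: "0 < lam \<sigma>" for \<sigma>
    using lam_ge_1[of \<sigma>] by linarith
  have e: "e k > 8 ^ k" for k
  proof -
    have "e k = energy a k (Pow {0..N (Suc k)}) - energy a k (Pow {0..N k})"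
      unfolding e_def B_def energy_def using N[of k] by (intro sum_diff) auto
    with big[of k] show ?thesis
      by simp
  qed
  have e_pos: "e k > 0" for k
    using e[of k] by (rule less_trans[rotated]) simp
  \<comment> \<open>Since \<open>lam \<sigma> \<ge> 1\<close>, the norm of order \<open>p\<close> is
    at most that of order \<open>k\<close>, whose square on the block is \<open>1 / e k\<close>. The
    rate \<open>(1 / 8) ^ k\<close> outweighs the factor \<open>4 ^ k\<close> required by
    \<open>L2_series\<close>.\<close>
  have c_bound: "(\<Sum>\<sigma>\<in>B k. (lam \<sigma> ^ p * cmod (c k \<sigma>))\<^sup>2) \<le> (1 / 8) ^ k" if "p \<le> k" for p k
  proof -
    have "lam \<sigma> ^ p * cmod (c k \<sigma>) \<le> cmod (a \<sigma>) / lam \<sigma> ^ k / e k" for \<sigma>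
    proof -
      have "lam \<sigma> ^ p * cmod (c k \<sigma>) \<le> lam \<sigma> ^ k * cmod (c k \<sigma>)"
        using that lam_ge_1 by (intro mult_right_mono power_increasing) auto
      also have "\<dots> = cmod (a \<sigma>) / lam \<sigma> ^ k / e k"
        using lam_pos[of \<sigma>] e_pos[of k]
        by (simp add: c_def norm_divide norm_mult norm_power mult_2 power_add)
      finally show ?thesis .
    qed
    then have "(\<Sum>\<sigma>\<in>B k. (lam \<sigma> ^ p * cmod (c k \<sigma>))\<^sup>2) \<le> (\<Sum>\<sigma>\<in>B k. (cmod (a \<sigma>) / lam \<sigma> ^ k / e k)\<^sup>2)"
      using less_imp_le[OF lam_pos] by (intro sum_mono power_mono mult_nonneg_nonneg zero_le_power norm_ge_zero)
    also have "\<dots> = e k / (e k)\<^sup>2"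
      by (simp only: power_divide[of _ "e k"] sum_divide_distrib[symmetric] energy_def[symmetric] e_def[symmetric])
    also have "\<dots> = 1 / e k"
      using e_pos[of k] by (simp add: power2_eq_square)
    also have "\<dots> \<le> 1 / 8 ^ k"
      using e[of k] by (intro divide_left_mono) (auto intro: mult_pos_pos e_pos)
    finally show ?thesis
      by (simp add: power_divide)
  qed
  have "summable (\<lambda>k. 4 ^ k * (\<integral>x. (cmod (X k x))\<^sup>2 \<partial>P))"
  proof (rule summable_comparison_test[OF exI[of _ 0]], intro allI impI)
    show "summable (\<lambda>k. (1 / 2 :: real) ^ k)"
      by (intro summable_geometric) auto
    fix k
    have "(\<integral>x. (cmod (X k x))\<^sup>2 \<partial>P) \<le> (1 / 8) ^ k"
      unfolding X_def integral_Zsum_square[OF B] using c_bound[of 0 k] by simp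
    then have "4 ^ k * (\<integral>x. (cmod (X k x))\<^sup>2 \<partial>P) \<le> 4 ^ k * (1 / 8) ^ k"
      by (intro mult_left_mono) auto
    also have "\<dots> = (1 / 2) ^ k"
      by (simp flip: power_mult_distrib)
    finally show "norm (4 ^ k * (\<integral>x. (cmod (X k x))\<^sup>2 \<partial>P)) \<le> (1 / 2) ^ k"
      by simp
  qed
  moreover have "X k \<in> L2 P M" for k
    unfolding X_def by (rule Zsum_L2[OF B(2)])
  ultimately obtain \<xi> where \<xi>: "\<xi> \<in> L2 P M"
    and sums: "\<And>\<eta>. \<eta> \<in> L2 P M \<Longrightarrow> (\<lambda>k. L2_inner P \<eta> (X k)) sums L2_inner P \<eta> \<xi>"
    using L2_series[of X] by blast
  have coef_sums: "(\<lambda>k. if \<sigma> \<in> B k then c k \<sigma> else 0) sums coef \<sigma> \<xi>" if "finite \<sigma>" for \<sigma>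
    using sums[OF Zprod_L2[OF that]] by (simp add: X_def coef_Zsum[OF B that])
  have disjoint: "k = j" if "\<sigma> \<in> B k" "\<sigma> \<in> B j" for \<sigma> k j
  proof (rule ccontr)
    have *: False if "\<sigma> \<in> B k" "\<sigma> \<in> B j" "k < j" for k j
    proof -
      have "N (Suc k) \<le> N j"
        using that(3) N_mono by (simp add: strict_mono_less_eq)
      then have "{0..N (Suc k)} \<subseteq> {0..N j}"
        by simp
      with that show False
        unfolding B_def by blast
    qed
    assume "k \<noteq> j"
    then show False
      using *[of k j] *[of j k] that by linarith
  qed
  have coef_B: "coef \<sigma> \<xi> = c k \<sigma>" if "\<sigma> \<in> B k" for \<sigma> k
  proof -
    have "(\<lambda>j. if \<sigma> \<in> B j then c j \<sigma> else 0) = (\<lambda>j. if j = k then c j \<sigma> else 0)"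
    proof (rule ext)
      show "(if \<sigma> \<in> B j then c j \<sigma> else 0) = (if j = k then c j \<sigma> else 0)" for j
        using disjoint[OF that, of j] that by (cases "\<sigma> \<in> B j") auto
    qed
    then have "(\<lambda>j. if j = k then c j \<sigma> else 0) sums coef \<sigma> \<xi>"
      using coef_sums[of \<sigma>] that B(2)[of k] by auto
    then show ?thesis
      by (rule sums_unique2[OF _ sums_single])
  qed
  have coef_0: "coef \<sigma> \<xi> = 0" if "\<sigma> \<in> Pow {0..N 0}" for \<sigma>
  proof -
    have "\<sigma> \<notin> B k" for k
    proof -
      have "{0..N 0} \<subseteq> {0..N k}"
        using N_mono by (simp add: strict_mono_less_eq)
      with that show ?thesis
        unfolding B_def by blast
    qed
    moreover have "finite \<sigma>"
      using that by (auto intro: finite_subset)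
    ultimately have "(\<lambda>k. 0) sums coef \<sigma> \<xi>"
      using coef_sums[of \<sigma>] by simp
    then show ?thesis
      by (rule sums_unique2[OF _ sums_zero])
  qed
  \<comment> \<open>The value type is left general because the decomposition serves real squared
    coefficients as well as complex pairings.\<close>
  have split: "(\<Sum>\<sigma>\<in>Pow {0..N K}. f \<sigma>) = (\<Sum>\<sigma>\<in>Pow {0..N 0}. f \<sigma>) + (\<Sum>k<K. \<Sum>\<sigma>\<in>B k. f \<sigma>)"
    for f :: "nat set \<Rightarrow> 'b::ab_group_add" and K
  proof (induction K)
    case (Suc K)
    have "(\<Sum>\<sigma>\<in>Pow {0..N (Suc K)}. f \<sigma>) = (\<Sum>\<sigma>\<in>B K. f \<sigma>) + (\<Sum>\<sigma>\<in>Pow {0..N K}. f \<sigma>)"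
      unfolding B_def using N[of K] by (intro sum.subset_diff) auto
    with Suc show ?case
      by (simp add: algebra_simps)
  qed simp
  have "\<xi> \<in> Sp P M p" for p
  proof (rule SpI[OF \<xi>])
    let ?D = "\<lambda>k. \<Sum>\<sigma>\<in>B k. (wcoef p \<xi> \<sigma>)\<^sup>2"
    fix A assume A: "finite A" "A \<subseteq> Gam"
    have "\<forall>\<^sub>F n in sequentially. A \<subseteq> Pow {0..n}"
      by (rule eventually_mono[OF filterlim_Pow_finite_subsets_at_top
              [unfolded filterlim_finite_subsets_at_top, rule_format, of A]])
        (simp_all add: A)
    then obtain K where K: "\<And>n. n \<ge> K \<Longrightarrow> A \<subseteq> Pow {0..n}"
      unfolding eventually_sequentially by blast
    \<comment> \<open>A strictly increasing sequence of naturals satisfies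
      \<open>K \<le> N K\<close>.\<close>
    have "A \<subseteq> Pow {0..N K}"
      by (rule K) (rule strict_mono_imp_increasing[OF N_mono])
    then have "(\<Sum>\<sigma>\<in>A. (wcoef p \<xi> \<sigma>)\<^sup>2) \<le> (\<Sum>\<sigma>\<in>Pow {0..N K}. (wcoef p \<xi> \<sigma>)\<^sup>2)"
      by (intro sum_mono2) auto
    also have "\<dots> = (\<Sum>k<K. ?D k)"
      unfolding split[of _ K] using coef_0 by (simp add: wcoef_def)
    \<comment> \<open>The blocks with \<open>k < p\<close> escape \<open>c_bound\<close>, but they
      are finitely many and contribute a constant independent of \<open>A\<close>. The others are
      dominated by a geometric series with sum 8/7, which is below 2.\<close>
    also have "\<dots> \<le> (\<Sum>k<K. (if k < p then ?D k else 0) + (1 / 8) ^ k)"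
    proof (rule sum_mono)
      fix k
      have "?D k \<le> (1 / 8) ^ k" if "p \<le> k"
        using c_bound[OF that] by (simp add: wcoef_def coef_B cong: sum.cong)
      then show "?D k \<le> (if k < p then ?D k else 0) + (1 / 8) ^ k"
        by auto
    qed
    also have "\<dots> = (\<Sum>k<K. if k < p then ?D k else 0) + (\<Sum>k<K. (1 / 8) ^ k)"
      by (rule sum.distrib)
    also have "\<dots> \<le> (\<Sum>k<p. ?D k) + 2"
    proof (rule add_mono)
      have "(\<Sum>k<K. if k < p then ?D k else 0) = (\<Sum>k\<in>{..<K} \<inter> {..<p}. ?D k)"
        by (simp add: sum.inter_restrict)
      also have "\<dots> \<le> (\<Sum>k<p. ?D k)"
        by (intro sum_mono2) (auto intro: sum_nonneg)
      finally show "(\<Sum>k<K. if k < p then ?D k else 0) \<le> (\<Sum>k<p. ?D k)" .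
      have "(\<Sum>k<K. (1 / 8 :: real) ^ k) \<le> (\<Sum>k. (1 / 8) ^ k)"
        by (intro sum_le_suminf summable_geometric) auto
      then show "(\<Sum>k<K. (1 / 8 :: real) ^ k) \<le> 2"
        by (simp add: suminf_geometric)
    qed
    finally show "L2_set (wcoef p \<xi>) A \<le> sqrt ((\<Sum>k<p. ?D k) + 2)"
      by (simp add: L2_set_def)
  qed
  then have "\<xi> \<in> S_space P M"
    by (simp add: S_space_def)
  moreover have "\<exists>n. cmod (\<Sum>\<sigma>\<in>Pow {0..n}. a \<sigma> * coef \<sigma> \<xi>) \<ge> real K" for K
  proof (intro exI)
    \<comment> \<open>Each block adds exactly 1 and the indices below the first cutoff add 0, so the
      pairing up to \<open>N K\<close> equals \<open>K\<close>.\<close>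
    have "(\<Sum>\<sigma>\<in>B k. a \<sigma> * coef \<sigma> \<xi>) = 1" for k
    proof -
      have "(\<Sum>\<sigma>\<in>B k. a \<sigma> * coef \<sigma> \<xi>) = (\<Sum>\<sigma>\<in>B k. complex_of_real ((cmod (a \<sigma>) / lam \<sigma> ^ k)\<^sup>2 / e k))"
      proof (rule sum.cong)
        fix \<sigma> assume "\<sigma> \<in> B k"
        then have "a \<sigma> * coef \<sigma> \<xi> = a \<sigma> * cnj (a \<sigma>) / complex_of_real (lam \<sigma> ^ (2 * k) * e k)"
          by (simp add: coef_B c_def)
        also have "\<dots> = complex_of_real ((cmod (a \<sigma>))\<^sup>2 / (lam \<sigma> ^ (2 * k) * e k))"
          by (simp only: complex_norm_square of_real_divide)
        also have "(cmod (a \<sigma>))\<^sup>2 / (lam \<sigma> ^ (2 * k) * e k) = (cmod (a \<sigma>) / lam \<sigma> ^ k)\<^sup>2 / e k"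
          by (simp add: power_divide power_even_eq)
        finally show "a \<sigma> * coef \<sigma> \<xi> = complex_of_real ((cmod (a \<sigma>) / lam \<sigma> ^ k)\<^sup>2 / e k)" .
      qed simp
      also have "\<dots> = complex_of_real (e k / e k)"
        by (simp only: of_real_sum[symmetric] sum_divide_distrib[symmetric] energy_def[symmetric] e_def[symmetric])
      finally show ?thesis
        using e_pos[of k] by simp
    qed
    then have "(\<Sum>\<sigma>\<in>Pow {0..N K}. a \<sigma> * coef \<sigma> \<xi>) = of_nat K"
      unfolding split[of _ K] using coef_0 by simp
    then show "real K \<le> cmod (\<Sum>\<sigma>\<in>Pow {0..N K}. a \<sigma> * coef \<sigma> \<xi>)"
      by simp
  qed
  ultimately show thesis
    by (rule that)
qed

end

section \<open>Generalized martingales\<close>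

lemma strong_topology_eq:
  "strong_topology P M = seminorm_topology (S_dual P M)
     {\<lambda>F. SUP f\<in>B. cmod (F f) | B. tvs_bounded (S_topology P M) B \<and> B \<noteq> {}}"
  by (simp add: strong_topology_def strong_dual_topology_def S_dual_def)

lemma weak_topology_eq:
  "weak_topology P M = seminorm_topology (S_dual P M) {\<lambda>F. cmod (F f) | f. f \<in> S_space P M}"
  by (simp add: weak_topology_def weak_dual_topology_def S_dual_def)

locale gen_martingale = discrete_normal_martingale +
  fixes \<Phi> :: "nat \<Rightarrow> ('a \<Rightarrow> complex) \<Rightarrow> complex"
  assumes gen_martingale: "generalized_martingale P M \<Phi>"
begin

section \<open>Fock coefficients of a generalized martingale\<close>

lemma \<Phi>_dual: "\<Phi> n \<in> S_dual P M"
  using gen_martingale by (simp add: generalized_martingale_def)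

text \<open>The maximum is the first time \<open>n\<close> at which \<open>\<sigma>\<close> is
  contained in \<open>{0..n}\<close>; inserting 0 covers the empty set.\<close>

definition fock :: "nat set \<Rightarrow> complex" where
  "fock \<sigma> = \<Phi> (Max (insert 0 \<sigma>)) (Zprod M \<sigma>)"

text \<open>The indicator annihilates the coefficient before \<open>\<sigma>\<close> fits into
  \<open>{0..n}\<close> and equals 1 afterwards, so from its first admissible time on the
  coefficient no longer changes.\<close>

lemma \<Phi>_Zprod:
  assumes "finite \<sigma>"
  shows "\<Phi> n (Zprod M \<sigma>) = (if \<sigma> \<subseteq> {0..n} then fock \<sigma> else 0)"
proof -
  have step: "\<Phi> n (Zprod M \<sigma>) = indicator (Pow {0..n}) \<sigma> * \<Phi> (Suc n) (Zprod M \<sigma>)" for n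
    by (rule gen_martingale[unfolded generalized_martingale_def Fock_transform_def, THEN conjunct2, rule_format])
      (simp add: assms)
  show ?thesis
  proof (cases "\<sigma> \<subseteq> {0..n}")
    case False
    then show ?thesis
      using step[of n] by simp
  next
    case True
    let ?m = "Max (insert 0 \<sigma>)"
    have m: "\<sigma> \<subseteq> {0..?m}"
      using assms by auto
    have "?m \<le> n"
      using True assms by auto
    then have "\<Phi> n (Zprod M \<sigma>) = \<Phi> ?m (Zprod M \<sigma>)"
    proof (induction n rule: dec_induct)
      case IH: (step k)
      have "\<sigma> \<subseteq> {0..k}"
        using m IH.hyps(1) by fastforce
      then show ?case
        using step[of k] IH.IH by simp
    qed simp
    then show ?thesis
      using True by (simp add: fock_def)
  qed
qed

lemma \<Phi>_eq:
  assumes "\<xi> \<in> S_space P M"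
  shows "\<Phi> n \<xi> = (\<Sum>\<sigma>\<in>Pow {0..n}. fock \<sigma> * coef \<sigma> \<xi>)"
proof -
  have "\<Phi> n \<xi> = (\<Sum>\<sigma>\<in>Pow {0..n}. \<Phi> n (Zprod M \<sigma>) * coef \<sigma> \<xi>)"
    by (rule S_dual_expansion[OF \<Phi>_dual assms]) (simp add: \<Phi>_Zprod)
  also have "\<dots> = (\<Sum>\<sigma>\<in>Pow {0..n}. fock \<sigma> * coef \<sigma> \<xi>)"
  proof (rule sum.cong)
    fix \<sigma> assume \<sigma>: "\<sigma> \<in> Pow {0..n}"
    then have "finite \<sigma>"
      using finite_Pow_Gam(2) by blast
    with \<sigma> show "\<Phi> n (Zprod M \<sigma>) * coef \<sigma> \<xi> = fock \<sigma> * coef \<sigma> \<xi>"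
      by (simp add: \<Phi>_Zprod)
  qed simp
  finally show ?thesis .
qed

abbreviation en :: "nat \<Rightarrow> nat \<Rightarrow> real" where
  "en p n \<equiv> energy fock p (Pow {0..n})"

section \<open>Weak boundedness, dual norms and bounded energy\<close>

lemma evaluation_weak_seminorm:
  "\<xi> \<in> S_space P M \<Longrightarrow> (\<lambda>F. cmod (F \<xi>)) \<in> {\<lambda>F. cmod (F f) | f. f \<in> S_space P M}"
  by (rule CollectI, rule exI[of _ \<xi>]) simp

lemma weakly_bounded_imp_energy:
  assumes "tvs_bounded (weak_topology P M) (range \<Phi>)"
  shows "\<exists>p K. \<forall>n. en p n \<le> K"
proof (rule ccontr)
  assume "\<not> ?thesis"
  then have "\<exists>n. en p n > K" for p K
    by (meson not_less)
  then obtain \<xi> where \<xi>: "\<xi> \<in> S_space P M"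
    "\<And>K. \<exists>n. cmod (\<Sum>\<sigma>\<in>Pow {0..n}. fock \<sigma> * coef \<sigma> \<xi>) \<ge> real K"
    by (rule gliding_hump) (rule that)
  from assms[unfolded weak_topology_eq weak.tvs_bounded_iff, THEN conjunct2, THEN bspec,
      OF evaluation_weak_seminorm[OF \<xi>(1)]]
  obtain C where C: "\<And>n. cmod (\<Phi> n \<xi>) \<le> C"
    by auto
  obtain K :: nat where K: "C < real K"
    using reals_Archimedean2 by blast
  obtain n where "real K \<le> cmod (\<Phi> n \<xi>)"
    using \<xi>(2)[of K] \<Phi>_eq[OF \<xi>(1)] by auto
  with C[of n] K show False
    by simp
qed

lemma energy_imp_Sp_bounded:
  assumes "\<And>n. en p n \<le> K"
  shows "\<exists>F\<in>Sp_dual P M p. restrict_functional (S_space P M) F = \<Phi> n \<and> Sp_dual_norm P M p F \<le> sqrt K"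
proof -
  \<comment> \<open>The finite sum representing \<open>\<Phi> n\<close> makes sense on all of
    \<open>Sp P M p\<close>; the value 0 elsewhere follows the convention for dual spaces.\<close>
  define F where "F \<xi> = (if \<xi> \<in> Sp P M p then \<Sum>\<sigma>\<in>Pow {0..n}. fock \<sigma> * coef \<sigma> \<xi> else 0)" for \<xi>
  have bound: "cmod (F \<xi>) \<le> sqrt K * Sp_norm P M p \<xi>" if "\<xi> \<in> Sp P M p" for \<xi>
  proof -
    have "cmod (F \<xi>) \<le> sqrt (en p n) * Sp_norm P M p \<xi>"
      using pairing_bound[OF finite_Pow_Gam that] that by (simp add: F_def)
    also have "\<dots> \<le> sqrt K * Sp_norm P M p \<xi>"
      using assms Sp_norm_nonneg by (intro mult_right_mono) auto
    finally show ?thesis .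
  qed
  have "F \<in> Sp_dual P M p"
    unfolding Sp_dual_def
  proof (rule Sp.topological_dualI)
    show "F (\<lambda>x. a * f x + b * g x) = a * F f + b * F g" if "f \<in> Sp P M p" "g \<in> Sp P M p" for f g a b
    proof -
      have "(\<lambda>x. a * f x + b * g x) \<in> Sp P M p"
        by (rule Sp_lincomb[OF that])
      then have "F (\<lambda>x. a * f x + b * g x) = (\<Sum>\<sigma>\<in>Pow {0..n}. fock \<sigma> * coef \<sigma> (\<lambda>x. a * f x + b * g x))"
        by (simp add: F_def)
      also have "\<dots> = (\<Sum>\<sigma>\<in>Pow {0..n}. a * (fock \<sigma> * coef \<sigma> f) + b * (fock \<sigma> * coef \<sigma> g))"
      proof (rule sum.cong)
        fix \<sigma> assume "\<sigma> \<in> Pow {0..n}"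
        then have "Zprod M \<sigma> \<in> L2 P M"
          using finite_Pow_Gam(2) by (intro Zprod_L2) blast
        from L2_inner_lincomb[OF this Sp_L2[OF that(1)] Sp_L2[OF that(2)]]
        show "fock \<sigma> * coef \<sigma> (\<lambda>x. a * f x + b * g x) = a * (fock \<sigma> * coef \<sigma> f) + b * (fock \<sigma> * coef \<sigma> g)"
          by (simp add: algebra_simps)
      qed simp
      also have "\<dots> = a * F f + b * F g"
        using that by (simp add: F_def sum.distrib sum_distrib_left)
      finally show ?thesis .
    qed
    show "cmod (F \<xi>) \<le> sqrt K * Sp_norm P M p \<xi>" if "\<xi> \<in> Sp P M p" for \<xi>
      by (rule bound[OF that])
  qed (simp_all add: F_def)
  moreover have "restrict_functional (S_space P M) F = \<Phi> n"
  proof (rule ext)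
    show "restrict_functional (S_space P M) F \<xi> = \<Phi> n \<xi>" for \<xi>
      using \<Phi>_eq[of \<xi> n] S_Sp[of \<xi> p] \<Phi>_dual[of n]
      by (simp add: restrict_functional_def F_def S_dual_def topological_dual_def)
  qed
  moreover have "Sp_dual_norm P M p F \<le> sqrt K"
    unfolding Sp_dual_norm_def
  proof (rule cSUP_least)
    have "(\<lambda>_. 0) \<in> Sp P M p" "Sp_norm P M p (\<lambda>_. 0) = 0"
      using function_space_zero[OF function_space_Sp] Sp.seminorm_zero by auto
    then show "{\<xi> \<in> Sp P M p. Sp_norm P M p \<xi> \<le> 1} \<noteq> {}"
      by (intro ex_in_conv[THEN iffD1] exI[of _ "\<lambda>_. 0"]) simp
    fix \<xi> assume \<xi>: "\<xi> \<in> {\<xi> \<in> Sp P M p. Sp_norm P M p \<xi> \<le> 1}"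
    have "0 \<le> K"
      using assms[of n] energy_nonneg[of fock p "Pow {0..n}"] by linarith
    then have "sqrt K * Sp_norm P M p \<xi> \<le> sqrt K * 1"
      using \<xi> by (intro mult_left_mono) auto
    with bound[of \<xi>] \<xi> show "cmod (F \<xi>) \<le> sqrt K"
      by simp
  qed
  ultimately show ?thesis
    by blast
qed

lemma Sp_bounded_imp_energy:
  assumes F: "F \<in> Sp_dual P M p" "restrict_functional (S_space P M) F = \<Phi> n"
    and C: "Sp_dual_norm P M p F \<le> C"
  shows "en p n \<le> C\<^sup>2"
proof -
  \<comment> \<open>The choice for which Cauchy-Schwarz is an equality: the functional takes the
    value \<open>en p n\<close> at a vector of norm \<open>sqrt (en p n)\<close>.\<close>
  define c where "c \<sigma> = cnj (fock \<sigma>) / complex_of_real (lam \<sigma> ^ (2 * p))" for \<sigma>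
  let ?\<xi> = "Zsum (Pow {0..n}) c"
  have lam_pos: "lam \<sigma> > 0" for \<sigma>
    using lam_ge_1[of \<sigma>] by linarith
  have \<xi>: "?\<xi> \<in> S_space P M"
    by (rule Zsum_S[OF finite_Pow_Gam])
  have "lam \<sigma> ^ p * cmod (c \<sigma>) = cmod (fock \<sigma>) / lam \<sigma> ^ p" for \<sigma>
    using lam_pos[of \<sigma>] by (simp add: c_def norm_divide norm_mult norm_power mult_2 power_add)
  then have norm: "Sp_norm P M p ?\<xi> = sqrt (en p n)"
    unfolding Sp_norm_Zsum[OF finite_Pow_Gam] by (simp add: L2_set_def energy_def)
  have "\<Phi> n ?\<xi> = (\<Sum>\<sigma>\<in>Pow {0..n}. fock \<sigma> * c \<sigma>)"
    unfolding \<Phi>_eq[OF \<xi>]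
  proof (rule sum.cong)
    fix \<sigma> assume \<sigma>: "\<sigma> \<in> Pow {0..n}"
    then have "finite \<sigma>"
      using finite_Pow_Gam(2) by blast
    with \<sigma> show "fock \<sigma> * coef \<sigma> ?\<xi> = fock \<sigma> * c \<sigma>"
      by (simp add: coef_Zsum[OF finite_Pow_Gam])
  qed simp
  also have "\<dots> = (\<Sum>\<sigma>\<in>Pow {0..n}. complex_of_real ((cmod (fock \<sigma>) / lam \<sigma> ^ p)\<^sup>2))"
  proof (rule sum.cong)
    fix \<sigma>
    have "fock \<sigma> * c \<sigma> = fock \<sigma> * cnj (fock \<sigma>) / complex_of_real (lam \<sigma> ^ (2 * p))"
      by (simp add: c_def)
    also have "\<dots> = complex_of_real ((cmod (fock \<sigma>))\<^sup>2 / lam \<sigma> ^ (2 * p))"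
      by (simp only: complex_norm_square of_real_divide)
    also have "(cmod (fock \<sigma>))\<^sup>2 / lam \<sigma> ^ (2 * p) = (cmod (fock \<sigma>) / lam \<sigma> ^ p)\<^sup>2"
      by (simp add: power_divide power_even_eq)
    finally show "fock \<sigma> * c \<sigma> = complex_of_real ((cmod (fock \<sigma>) / lam \<sigma> ^ p)\<^sup>2)" .
  qed simp
  also have "\<dots> = complex_of_real (en p n)"
    by (simp add: energy_def)
  finally have "cmod (\<Phi> n ?\<xi>) = en p n"
    by (simp add: energy_nonneg)
  moreover have "F ?\<xi> = \<Phi> n ?\<xi>"
    using \<xi> by (simp add: F(2)[symmetric] restrict_functional_def)
  ultimately have "en p n \<le> Sp_dual_norm P M p F * sqrt (en p n)"
    using Sp_dual_bound[OF F(1) S_Sp[OF \<xi>]] norm by simp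
  also have "\<dots> \<le> C * sqrt (en p n)"
    using C by (intro mult_right_mono) (auto simp: energy_nonneg)
  finally have le: "sqrt (en p n) * sqrt (en p n) \<le> C * sqrt (en p n)"
    by (simp add: energy_nonneg)
  \<comment> \<open>Cancelling \<open>sqrt (en p n)\<close> requires it to be nonzero; if it is 0,
    the claim is trivial.\<close>
  show ?thesis
  proof (cases "en p n = 0")
    case False
    then have "sqrt (en p n) > 0"
      using energy_nonneg[of fock p "Pow {0..n}"] by simp
    with le have "sqrt (en p n) \<le> C"
      by (rule mult_right_le_imp_le)
    then show ?thesis
      by (rule sqrt_le_D)
  qed simp
qed

section \<open>Strong boundedness and strong convergence\<close>

lemma S_bounded_obtain:
  assumes "tvs_bounded (S_topology P M) B"
  obtains D where "D \<ge> 0" "B \<subseteq> S_space P M" "\<And>\<xi>. \<xi> \<in> B \<Longrightarrow> Sp_norm P M p \<xi> \<le> D"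
proof -
  have B: "B \<subseteq> S_space P M \<and> (\<forall>q\<in>range (Sp_norm P M). \<exists>C. \<forall>\<xi>\<in>B. q \<xi> \<le> C)"
    using assms unfolding S_topology_def S.tvs_bounded_iff .
  then obtain D where "\<forall>\<xi>\<in>B. Sp_norm P M p \<xi> \<le> D"
    by (meson rangeI)
  with B show thesis
    by (intro that[of "max 0 D"]) (auto simp: le_max_iff_disj)
qed

lemma S_bounded_singleton: "\<xi> \<in> S_space P M \<Longrightarrow> tvs_bounded (S_topology P M) {\<xi>}"
  unfolding S_topology_def by (rule S.tvs_bounded_singleton)

text \<open>A bounded subset of \<open>S_space P M\<close> is bounded in the norm of order
  \<open>p\<close> in particular, so \<open>pairing_bound\<close> is uniform over it and over
  \<open>n\<close>.\<close>

lemma energy_imp_strongly_bounded: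
  assumes "\<And>n. en p n \<le> K"
  shows "tvs_bounded (strong_topology P M) (range \<Phi>)"
  unfolding strong_topology_eq strong.tvs_bounded_iff
proof (intro conjI ballI)
  show "range \<Phi> \<subseteq> S_dual P M"
    using \<Phi>_dual by blast
  fix q assume "q \<in> {\<lambda>F. SUP f\<in>B. cmod (F f) | B. tvs_bounded (S_topology P M) B \<and> B \<noteq> {}}"
  then obtain B where q: "q = (\<lambda>F. SUP f\<in>B. cmod (F f))" and B: "tvs_bounded (S_topology P M) B" "B \<noteq> {}"
    by blast
  obtain D where D: "D \<ge> 0" "B \<subseteq> S_space P M" "\<And>\<xi>. \<xi> \<in> B \<Longrightarrow> Sp_norm P M p \<xi> \<le> D"
    using S_bounded_obtain[OF B(1)] by blast
  have "q (\<Phi> n) \<le> sqrt K * D" for n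
    unfolding q
  proof (rule cSUP_least[OF B(2)])
    fix \<xi> assume \<xi>: "\<xi> \<in> B"
    then have S: "\<xi> \<in> S_space P M"
      using D(2) by blast
    have "0 \<le> K"
      using assms[of n] energy_nonneg[of fock p "Pow {0..n}"] by linarith
    have "cmod (\<Phi> n \<xi>) \<le> sqrt (en p n) * Sp_norm P M p \<xi>"
      unfolding \<Phi>_eq[OF S] by (rule pairing_bound[OF finite_Pow_Gam S_Sp[OF S]])
    also have "\<dots> \<le> sqrt K * D"
      using assms D(3)[OF \<xi>] \<open>0 \<le> K\<close> Sp_norm_nonneg by (intro mult_mono) auto
    finally show "cmod (\<Phi> n \<xi>) \<le> sqrt K * D" .
  qed
  then show "\<exists>C. \<forall>F\<in>range \<Phi>. q F \<le> C"
    by blast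
qed

text \<open>The values at each \<open>\<xi>\<close> are Cauchy with a constant, the root of the
  remaining energy \<open>L - en p n\<close>, that does not depend on \<open>\<xi>\<close>. Passing
  to the limit keeps the constant, so convergence is uniform wherever the norm of order
  \<open>p\<close> is bounded.\<close>

lemma energy_imp_strongly_convergent:
  assumes K: "\<And>n. en p n \<le> K"
  shows "\<exists>\<Psi>. limitin (strong_topology P M) \<Phi> \<Psi> sequentially"
proof -
  have mono: "incseq (en p)"
    unfolding incseq_def energy_def by (auto intro!: sum_mono2)
  then obtain L where L: "en p \<longlonglongrightarrow> L"
    using incseq_convergent[of "en p" K] K by blast
  have en_le: "en p n \<le> L" for n
    by (rule incseq_le[OF mono L])
  \<comment> \<open>The difference involves only index sets that are new since \<open>n\<close>;
    their energy is \<open>en p m - en p n\<close>, hence at most \<open>L - en p n\<close>.\<close>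
  have diff: "cmod (\<Phi> m \<xi> - \<Phi> n \<xi>) \<le> sqrt (L - en p n) * Sp_norm P M p \<xi>"
    if "n \<le> m" "\<xi> \<in> S_space P M" for m n \<xi>
  proof -
    have sub: "Pow {0..n} \<subseteq> Pow {0..m}"
      using that(1) by auto
    have "\<Phi> m \<xi> - \<Phi> n \<xi> = (\<Sum>\<sigma>\<in>Pow {0..m} - Pow {0..n}. fock \<sigma> * coef \<sigma> \<xi>)"
      unfolding \<Phi>_eq[OF that(2)] by (rule sum_diff[OF finite_Pow_Gam(1) sub, symmetric])
    also have "cmod \<dots> \<le> sqrt (energy fock p (Pow {0..m} - Pow {0..n})) * Sp_norm P M p \<xi>"
      using finite_Pow_Gam by (intro pairing_bound S_Sp[OF that(2)]) blast+
    also have "energy fock p (Pow {0..m} - Pow {0..n}) = en p m - en p n"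
      unfolding energy_def by (rule sum_diff[OF finite_Pow_Gam(1) sub])
    also have "sqrt (en p m - en p n) * Sp_norm P M p \<xi> \<le> sqrt (L - en p n) * Sp_norm P M p \<xi>"
      using en_le[of m] Sp_norm_nonneg by (intro mult_right_mono) auto
    finally show ?thesis .
  qed
  have tail: "(\<lambda>n. sqrt (L - en p n)) \<longlonglongrightarrow> 0"
    using tendsto_real_sqrt[OF tendsto_diff[OF tendsto_const L, of L]] by simp
  have conv: "convergent (\<lambda>n. \<Phi> n \<xi>)" if \<xi>: "\<xi> \<in> S_space P M" for \<xi>
  proof (rule Cauchy_convergent, rule metric_CauchyI)
    fix e :: real assume "e > 0"
    have "(\<lambda>n. sqrt (L - en p n) * Sp_norm P M p \<xi>) \<longlonglongrightarrow> 0"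
      using tendsto_mult_left_zero[OF tail] .
    then obtain N where N: "sqrt (L - en p N) * Sp_norm P M p \<xi> < e / 2"
      using order_tendstoD(2)[of _ 0 sequentially "e / 2"] \<open>e > 0\<close>
      unfolding eventually_sequentially by (metis half_gt_zero order_refl)
    have "dist (\<Phi> m \<xi>) (\<Phi> n \<xi>) < e" if "m \<ge> N" "n \<ge> N" for m n
      using diff[OF that(1) \<xi>] diff[OF that(2) \<xi>] N dist_triangle2[of "\<Phi> m \<xi>" "\<Phi> n \<xi>" "\<Phi> N \<xi>"]
      by (simp add: dist_norm)
    then show "\<exists>N. \<forall>m\<ge>N. \<forall>n\<ge>N. dist (\<Phi> m \<xi>) (\<Phi> n \<xi>) < e"
      by blast
  qed
  define \<Psi> where "\<Psi> \<xi> = (if \<xi> \<in> S_space P M then lim (\<lambda>n. \<Phi> n \<xi>) else 0)" for \<xi>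
  have lim: "(\<lambda>n. \<Phi> n \<xi>) \<longlonglongrightarrow> \<Psi> \<xi>" if "\<xi> \<in> S_space P M" for \<xi>
    using conv[OF that] that by (simp add: \<Psi>_def convergent_LIMSEQ_iff)
  have tail_bound: "cmod (\<Psi> \<xi> - \<Phi> n \<xi>) \<le> sqrt (L - en p n) * Sp_norm P M p \<xi>"
    if \<xi>: "\<xi> \<in> S_space P M" for \<xi> n
  proof (rule LIMSEQ_le_const2)
    show "(\<lambda>m. cmod (\<Phi> m \<xi> - \<Phi> n \<xi>)) \<longlonglongrightarrow> cmod (\<Psi> \<xi> - \<Phi> n \<xi>)"
      by (intro tendsto_intros lim \<xi>)
    show "\<exists>N. \<forall>m\<ge>N. cmod (\<Phi> m \<xi> - \<Phi> n \<xi>) \<le> sqrt (L - en p n) * Sp_norm P M p \<xi>"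
      using diff[OF _ \<xi>] by blast
  qed
  have \<Psi>: "\<Psi> \<in> S_dual P M"
    unfolding S_dual_def S_topology_def
  proof (rule S.topological_dualI)
    show "\<Psi> (\<lambda>x. a * f x + b * g x) = a * \<Psi> f + b * \<Psi> g" if "f \<in> S_space P M" "g \<in> S_space P M" for f g a b
    proof (rule LIMSEQ_unique)
      show "(\<lambda>n. \<Phi> n (\<lambda>x. a * f x + b * g x)) \<longlonglongrightarrow> \<Psi> (\<lambda>x. a * f x + b * g x)"
        by (rule lim[OF function_space_lincomb[OF function_space_S that]])
      show "(\<lambda>n. \<Phi> n (\<lambda>x. a * f x + b * g x)) \<longlonglongrightarrow> a * \<Psi> f + b * \<Psi> g"
        unfolding S_dual_linear[OF \<Phi>_dual that] by (intro tendsto_intros lim that)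
    qed
    show "\<Psi> f = 0" if "f \<notin> S_space P M" for f
      using that by (simp add: \<Psi>_def)
    show "Sp_norm P M p \<in> range (Sp_norm P M)"
      by blast
    \<comment> \<open>Continuity of the limit comes from comparison with \<open>\<Phi> 0\<close>:
      one term bounds the distance to it, the other bounds \<open>\<Phi> 0\<close> itself.\<close>
    show "cmod (\<Psi> \<xi>) \<le> (sqrt (L - en p 0) + sqrt (en p 0)) * Sp_norm P M p \<xi>" if \<xi>: "\<xi> \<in> S_space P M" for \<xi>
    proof -
      have "cmod (\<Phi> 0 \<xi>) \<le> sqrt (en p 0) * Sp_norm P M p \<xi>"
        unfolding \<Phi>_eq[OF \<xi>] by (rule pairing_bound[OF finite_Pow_Gam S_Sp[OF \<xi>]])
      with tail_bound[OF \<xi>, of 0] norm_triangle_ineq[of "\<Psi> \<xi> - \<Phi> 0 \<xi>" "\<Phi> 0 \<xi>"] show ?thesis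
        by (simp add: distrib_right)
    qed
  qed
  have "limitin (strong_topology P M) \<Phi> \<Psi> sequentially"
    unfolding strong_topology_eq strong.limitin_iff[OF \<Phi>_dual]
  proof (intro conjI ballI \<Psi>)
    fix q assume "q \<in> {\<lambda>F. SUP f\<in>B. cmod (F f) | B. tvs_bounded (S_topology P M) B \<and> B \<noteq> {}}"
    then obtain B where q: "q = (\<lambda>F. SUP f\<in>B. cmod (F f))" and B: "tvs_bounded (S_topology P M) B" "B \<noteq> {}"
      by blast
    obtain D where D: "D \<ge> 0" "B \<subseteq> S_space P M" "\<And>\<xi>. \<xi> \<in> B \<Longrightarrow> Sp_norm P M p \<xi> \<le> D"
      using S_bounded_obtain[OF B(1)] by blast
    have bound: "cmod (\<Phi> n \<xi> - \<Psi> \<xi>) \<le> sqrt (L - en p n) * D" if "\<xi> \<in> B" for n \<xi>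
    proof -
      have "cmod (\<Phi> n \<xi> - \<Psi> \<xi>) \<le> sqrt (L - en p n) * Sp_norm P M p \<xi>"
        using tail_bound[of \<xi> n] D(2) that by (auto simp: norm_minus_commute)
      also have "\<dots> \<le> sqrt (L - en p n) * D"
        using D(3)[OF that] en_le[of n] by (intro mult_left_mono) auto
      finally show ?thesis .
    qed
    have upper: "q (\<lambda>\<xi>. \<Phi> n \<xi> - \<Psi> \<xi>) \<le> sqrt (L - en p n) * D" for n
      unfolding q using bound by (intro cSUP_least[OF B(2)])
    have lower: "0 \<le> q (\<lambda>\<xi>. \<Phi> n \<xi> - \<Psi> \<xi>)" for n
    proof -
      obtain \<xi> where "\<xi> \<in> B"
        using B(2) by blast
      then show ?thesis
        unfolding q using bound by (intro cSUP_upper2[of _ _ \<xi>] bdd_aboveI2) auto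
    qed
    show "(\<lambda>n. q (\<lambda>\<xi>. \<Phi> n \<xi> - \<Psi> \<xi>)) \<longlonglongrightarrow> 0"
    proof (rule tendsto_sandwich[OF _ _ tendsto_const])
      show "(\<lambda>n. sqrt (L - en p n) * D) \<longlonglongrightarrow> 0"
        by (rule tendsto_mult_left_zero[OF tail])
    qed (use upper lower in auto)
  qed
  then show ?thesis
    by blast
qed

section \<open>Passing from the strong to the weak topology\<close>

lemma pointwise_bounded_imp_weakly_bounded:
  assumes "\<And>\<xi>. \<xi> \<in> S_space P M \<Longrightarrow> \<exists>C. \<forall>n. cmod (\<Phi> n \<xi>) \<le> C"
  shows "tvs_bounded (weak_topology P M) (range \<Phi>)"
  unfolding weak_topology_eq weak.tvs_bounded_iff
proof (intro conjI ballI)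
  show "range \<Phi> \<subseteq> S_dual P M"
    using \<Phi>_dual by blast
  fix q assume "q \<in> {\<lambda>F. cmod (F f) | f. f \<in> S_space P M}"
  then obtain \<xi> where "q = (\<lambda>F. cmod (F \<xi>))" "\<xi> \<in> S_space P M"
    by blast
  then show "\<exists>C. \<forall>F\<in>range \<Phi>. q F \<le> C"
    using assms[of \<xi>] by simp
qed

text \<open>A singleton is bounded and the supremum over it is evaluation; strong statements thereby
  specialise to pointwise ones.\<close>

lemma evaluation_strong_seminorm:
  assumes "\<xi> \<in> S_space P M"
  shows "(\<lambda>F. cmod (F \<xi>)) \<in> {\<lambda>F. SUP f\<in>B. cmod (F f) | B. tvs_bounded (S_topology P M) B \<and> B \<noteq> {}}"
  by (rule CollectI, rule exI[of _ "{\<xi>}"]) (simp add: S_bounded_singleton[OF assms])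

lemma strongly_bounded_imp_weakly_bounded:
  assumes "tvs_bounded (strong_topology P M) (range \<Phi>)"
  shows "tvs_bounded (weak_topology P M) (range \<Phi>)"
proof (rule pointwise_bounded_imp_weakly_bounded)
  fix \<xi> assume "\<xi> \<in> S_space P M"
  from assms[unfolded strong_topology_eq strong.tvs_bounded_iff, THEN conjunct2, THEN bspec,
      OF evaluation_strong_seminorm[OF this]]
  show "\<exists>C. \<forall>n. cmod (\<Phi> n \<xi>) \<le> C"
    by simp
qed

lemma strongly_convergent_imp_weakly_bounded:
  assumes "limitin (strong_topology P M) \<Phi> \<Psi> sequentially"
  shows "tvs_bounded (weak_topology P M) (range \<Phi>)"
proof (rule pointwise_bounded_imp_weakly_bounded)
  fix \<xi> assume "\<xi> \<in> S_space P M"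
  from assms[unfolded strong_topology_eq strong.limitin_iff[OF \<Phi>_dual], THEN conjunct2, THEN bspec,
      OF evaluation_strong_seminorm[OF this]]
  have "(\<lambda>n. \<Phi> n \<xi> - \<Psi> \<xi>) \<longlonglongrightarrow> 0"
    by (simp add: tendsto_norm_zero_iff)
  then have "(\<lambda>n. \<Phi> n \<xi>) \<longlonglongrightarrow> \<Psi> \<xi>"
    by (rule LIM_zero_cancel)
  then have "Bseq (\<lambda>n. \<Phi> n \<xi>)"
    by (intro convergent_imp_Bseq convergentI)
  then show "\<exists>C. \<forall>n. cmod (\<Phi> n \<xi>) \<le> C"
    by (auto simp: Bseq_def)
qed

end

theorem theorem4p4:
  fixes P :: "'a measure" and M :: "nat \<Rightarrow> 'a \<Rightarrow> real"
    and \<Phi> :: "nat \<Rightarrow> ('a \<Rightarrow> complex) \<Rightarrow> complex"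
  assumes "normal_martingale P M"
    and "chaotic_representation P M"
    and "generalized_martingale P M \<Phi>"
  shows "((\<exists>\<Psi>. limitin (strong_topology P M) \<Phi> \<Psi> sequentially)
            \<longleftrightarrow> tvs_bounded (weak_topology P M) (range \<Phi>))
       \<and> (tvs_bounded (weak_topology P M) (range \<Phi>)
            \<longleftrightarrow> tvs_bounded (strong_topology P M) (range \<Phi>))
       \<and> (tvs_bounded (strong_topology P M) (range \<Phi>)
            \<longleftrightarrow> (\<exists>p C. \<forall>n. \<exists>F\<in>Sp_dual P M p.
                   restrict_functional (S_space P M) F = \<Phi> n \<and> Sp_dual_norm P M p F \<le> C))"
proof -
  interpret gen_martingale P M \<Phi>
    using assms by unfold_locales
  let ?weak = "tvs_bounded (weak_topology P M) (range \<Phi>)"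
  let ?energy = "\<exists>p K. \<forall>n. en p n \<le> K"
  \<comment> \<open>The cycle runs from weak boundedness to bounded energy by the gliding hump, then
    to strong boundedness, and back to weak boundedness.\<close>
  have weak: "?weak \<longleftrightarrow> ?energy"
    using weakly_bounded_imp_energy energy_imp_strongly_bounded strongly_bounded_imp_weakly_bounded
    by blast
  have strong: "tvs_bounded (strong_topology P M) (range \<Phi>) \<longleftrightarrow> ?energy"
    using weak energy_imp_strongly_bounded strongly_bounded_imp_weakly_bounded by blast
  have convergent: "(\<exists>\<Psi>. limitin (strong_topology P M) \<Phi> \<Psi> sequentially) \<longleftrightarrow> ?energy"
    using weak energy_imp_strongly_convergent strongly_convergent_imp_weakly_bounded by blast
  have Sp: "(\<exists>p C. \<forall>n. \<exists>F\<in>Sp_dual P M p.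
      restrict_functional (S_space P M) F = \<Phi> n \<and> Sp_dual_norm P M p F \<le> C) \<longleftrightarrow> ?energy"
  proof
    assume "\<exists>p C. \<forall>n. \<exists>F\<in>Sp_dual P M p.
      restrict_functional (S_space P M) F = \<Phi> n \<and> Sp_dual_norm P M p F \<le> C"
    then obtain p C where "\<forall>n. \<exists>F\<in>Sp_dual P M p.
      restrict_functional (S_space P M) F = \<Phi> n \<and> Sp_dual_norm P M p F \<le> C"
      by blast
    then have "\<forall>n. en p n \<le> C\<^sup>2"
      using Sp_bounded_imp_energy by blast
    then show ?energy
      by blast
  next
    assume ?energy
    then obtain p K where "\<And>n. en p n \<le> K"
      by blast
    then show "\<exists>p C. \<forall>n. \<exists>F\<in>Sp_dual P M p.
      restrict_functional (S_space P M) F = \<Phi> n \<and> Sp_dual_norm P M p F \<le> C"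
      using energy_imp_Sp_bounded by blast
  qed
  show ?thesis
    unfolding weak strong convergent Sp by simp
qed

end
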